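(* Fix $R_p,R_I,r_p,r_I>0$. A sufficient condition for the connectivity of $\mathcal{G}(\lambda_S,\lambda_{PT})$ is $$\lambda_{PT}<\frac{1}{\pi\left[R_I^2+r_I^2-I(R_I,R_p,r_I)\right]}\,\ln\frac{1-\exp\left(-\frac{\lambda_S r_p^2}{8}\right)}{1-\left(\frac13\right)^{(2k+1)^2}},$$ where $$I(R_I,R_p,r_I)=2\int_0^{R_I}t\,\frac{S_I(t,R_p,r_I)}{\pi R_p^2}\,\mathrm{d}t,\qquad k=\left\lceil\frac{8\max\left\{R_I+\frac{r_p}{4},\,r_I+\frac{r_p}{4}\right\}}{r_p}\right\rceil-1,$$ and $S_I(t,R_p,r_I)$ is the common area of two disks with radii $R_p$ and $r_I$ whose centers are at distance $t$.
   Context: Heterogeneous network model in $\mathbb{R}^2$ with fixed parameters $R_p,R_I,r_p,r_I>0$ and densities $\lambda_S>0$, $\lambda_{PT}\ge 0$. Primary transmitters form a homogeneous Poisson point process of density $\lambda_{PT}$; each primary transmitter has one primary receiver, located uniformly at random in the disk of radius $R_p$ centered at the transmitter, independently for different transmitters. Secondary users form a homogeneous Poisson point process of density $\lambda_S$, independent of the primary transmitters and receivers. A secondary user sees an opportunity if there is no primary transmitter within distance $R_I$ of it and no primary receiver within distance $r_I$ of it. $\mathcal{G}(\lambda_S,\lambda_{PT})$ is the undirected random graph whose vertices are the secondary users, with an edge between two distinct secondary users $A,B$ if and only if their distance is at most $r_p$ and both $A$ and $B$ see an opportunity. $\mathcal{G}(\lambda_S,\lambda_{PT})$ is called connected if almost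 surely it contains an infinite connected component. *)

theory Defs
  imports "HOL-Probability.Probability"
begin

section \<open>Poisson point processes\<close>

text \<open>
  Locally finite point configurations, with the \<open>\<sigma>\<close>-algebra generated by the numbers of points in
  bounded Borel sets.
\<close>

definition point_configs :: "'a::euclidean_space set measure" where
  "point_configs = sigma {X. \<forall>B. bounded B \<longrightarrow> finite (X \<inter> B)}
     {{X. (\<forall>B. bounded B \<longrightarrow> finite (X \<inter> B)) \<and> card (X \<inter> A) = n} | A n. A \<in> sets borel \<and> bounded A}"

text \<open>
  The homogeneous Poisson point process of density \<open>\<rho>\<close>. The Poisson probabilities are spelled out since
  \<^const>\<open>poisson_pmf\<close> is meant for a positive rate only, whereas \<open>\<rho> = 0\<close> (almost surely no points) and
  null sets \<open>A\<close> occur here.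
\<close>

definition (in prob_space) poisson_point_process ::
    "real \<Rightarrow> ('a \<Rightarrow> 'b::euclidean_space set) \<Rightarrow> bool" where
  "poisson_point_process \<rho> \<Phi> \<longleftrightarrow>
     random_variable point_configs \<Phi> \<and>
     (\<forall>A\<in>sets borel. bounded A \<longrightarrow> (\<forall>n.
        prob {\<omega> \<in> space M. card (\<Phi> \<omega> \<inter> A) = n} =
          (\<rho> * measure lborel A) ^ n / fact n * exp (- (\<rho> * measure lborel A)))) \<and>
     (\<forall>A :: nat \<Rightarrow> 'b set. (\<forall>i. A i \<in> sets borel \<and> bounded (A i)) \<longrightarrow> disjoint_family A \<longrightarrow>
        indep_vars (\<lambda>_. count_space UNIV) (\<lambda>i \<omega>. card (\<Phi> \<omega> \<inter> A i)) UNIV)"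

text \<open>
  \<^const>\<open>prob_space.indep_var\<close> forces both random elements to take values in the same type; this is the
  version for random elements of different types.
\<close>

definition (in prob_space) indep_elements ::
    "'b measure \<Rightarrow> ('a \<Rightarrow> 'b) \<Rightarrow> 'c measure \<Rightarrow> ('a \<Rightarrow> 'c) \<Rightarrow> bool" where
  "indep_elements MX X MY Y \<longleftrightarrow>
     random_variable MX X \<and> random_variable MY Y \<and>
     indep_set (sets (vimage_algebra (space M) X MX)) (sets (vimage_algebra (space M) Y MY))"

section \<open>The network model\<close>

text \<open>
  \<open>SU \<omega>\<close> is the set of secondary users. The primary transmitters are enumerated without repetition
  as \<open>T n \<omega>\<close> for \<open>n < N \<omega>\<close> (\<open>N \<omega> = \<infinity>\<close> is the almost sure case for positive density, \<open>N \<omega> = 0\<close> for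
  density \<open>0\<close>), so that each of them can carry its own receiver. The receiver of \<open>T n \<omega>\<close> sits at
  \<open>T n \<omega> + D n \<omega>\<close>, where the displacements \<open>D n\<close> are i.i.d. uniform on the disk of radius \<open>R\<^sub>p\<close> about
  the origin and independent of the enumerated transmitters. The values \<open>T n \<omega>\<close> and \<open>D n \<omega>\<close> for
  \<open>n \<ge> N \<omega>\<close> play no role.
\<close>

definition transmitters :: "('w \<Rightarrow> enat) \<Rightarrow> (nat \<Rightarrow> 'w \<Rightarrow> real^2) \<Rightarrow> 'w \<Rightarrow> (real^2) set" where
  "transmitters N T \<omega> = {T n \<omega> | n. enat n < N \<omega>}"

definition receivers ::
    "('w \<Rightarrow> enat) \<Rightarrow> (nat \<Rightarrow> 'w \<Rightarrow> real^2) \<Rightarrow> (nat \<Rightarrow> 'w \<Rightarrow> real^2) \<Rightarrow> 'w \<Rightarrow> (real^2) set" where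
  "receivers N T D \<omega> = {T n \<omega> + D n \<omega> | n. enat n < N \<omega>}"

locale heterogeneous_network = prob_space M
  for M :: "'w measure" +
  fixes lamS lamPT Rp :: real
    and SU :: "'w \<Rightarrow> (real^2) set"
    and N :: "'w \<Rightarrow> enat"
    and T D :: "nat \<Rightarrow> 'w \<Rightarrow> real^2"
  assumes secondary_users: "poisson_point_process lamS SU"
    and primary_transmitters: "poisson_point_process lamPT (transmitters N T)"
    and enumeration_inj: "\<And>\<omega>. \<omega> \<in> space M \<Longrightarrow> inj_on (\<lambda>n. T n \<omega>) {n. enat n < N \<omega>}"
    and displacement_uniform: "\<And>n. distr M borel (D n) = uniform_measure lborel (cball 0 Rp)"
    and displacement_indep: "indep_vars (\<lambda>_. borel) D UNIV"
    and displacements_indep_transmitters: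
      "indep_elements
         (PiM UNIV (\<lambda>_. borel)) (\<lambda>\<omega> n. D n \<omega>)
         (count_space UNIV \<Otimes>\<^sub>M PiM UNIV (\<lambda>_. borel)) (\<lambda>\<omega>. (N \<omega>, \<lambda>n. T n \<omega>))"
    and secondary_indep_primary:
      "indep_elements
         point_configs SU
         (count_space UNIV \<Otimes>\<^sub>M PiM UNIV (\<lambda>_. borel) \<Otimes>\<^sub>M PiM UNIV (\<lambda>_. borel))
         (\<lambda>\<omega>. (N \<omega>, \<lambda>n. T n \<omega>, \<lambda>n. D n \<omega>))"

definition opportunity :: "real \<Rightarrow> real \<Rightarrow> (real^2) set \<Rightarrow> (real^2) set \<Rightarrow> real^2 \<Rightarrow> bool" where
  "opportunity RI rI PT PR A \<longleftrightarrow>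
     \<not> (\<exists>x\<in>PT. dist A x \<le> RI) \<and> \<not> (\<exists>y\<in>PR. dist A y \<le> rI)"

definition secondary_edges ::
    "real \<Rightarrow> real \<Rightarrow> real \<Rightarrow> (real^2) set \<Rightarrow> (real^2) set \<Rightarrow> (real^2) set \<Rightarrow> ((real^2) \<times> (real^2)) set" where
  "secondary_edges rp RI rI PT PR V =
     {(A, B). A \<in> V \<and> B \<in> V \<and> A \<noteq> B \<and> dist A B \<le> rp \<and>
        opportunity RI rI PT PR A \<and> opportunity RI rI PT PR B}"

text \<open>The vertex sets of the connected components of the graph with vertices \<open>V\<close> and symmetric
  adjacency relation \<open>E\<close>.\<close>

definition connected_components_of :: "'v set \<Rightarrow> ('v \<times> 'v) set \<Rightarrow> 'v set set" where
  "connected_components_of V E = V // {(x, y). x \<in> V \<and> y \<in> V \<and> (x, y) \<in> E\<^sup>*}"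

definition secondary_network_connected ::
    "'w measure \<Rightarrow> real \<Rightarrow> real \<Rightarrow> real \<Rightarrow> ('w \<Rightarrow> (real^2) set) \<Rightarrow> ('w \<Rightarrow> enat) \<Rightarrow>
     (nat \<Rightarrow> 'w \<Rightarrow> real^2) \<Rightarrow> (nat \<Rightarrow> 'w \<Rightarrow> real^2) \<Rightarrow> bool" where
  "secondary_network_connected M rp RI rI SU N T D \<longleftrightarrow>
     (AE \<omega> in M. \<exists>C \<in> connected_components_of (SU \<omega>)
        (secondary_edges rp RI rI (transmitters N T \<omega>) (receivers N T D \<omega>) (SU \<omega>)). infinite C)"

section \<open>The constants of the sufficient condition\<close>

definition common_area :: "real \<Rightarrow> real \<Rightarrow> real \<Rightarrow> real" where
  "common_area t r1 r2 = measure lborel (cball (0 :: real^2) r1 \<inter> cball (vector [t, 0]) r2)"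

definition overlap_integral :: "real \<Rightarrow> real \<Rightarrow> real \<Rightarrow> real" where
  "overlap_integral RI Rp rI =
     2 * integral {0..RI} (\<lambda>t. t * (common_area t Rp rI / (pi * Rp\<^sup>2)))"

text \<open>For positive arguments the ceiling is at least \<open>3\<close>, so the conversion to \<^typ>\<open>nat\<close> never truncates.\<close>

definition dependence_range :: "real \<Rightarrow> real \<Rightarrow> real \<Rightarrow> nat" where
  "dependence_range RI rp rI = nat (\<lceil>8 * max (RI + rp / 4) (rI + rp / 4) / rp\<rceil> - 1)"

end

theory Submission
  imports Defs
begin

text \<open>
  Peierls argument. Cut the plane into half-open squares of diagonal \<open>r\<^sub>p / 2\<close>; users in squares that
  share a corner are within distance \<open>r\<^sub>p\<close>. A square is good if it contains a user near a chosen centre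
  whose slightly enlarged disks avoid all primary transmitters and receivers. Distant squares are not
  independent, because a transmitter can be far from its receiver, so the probability that all squares
  of a set \<open>W\<close> are bad is bounded by an exponential moment of the number of blocked centres, which is a
  Laplace functional of the Poisson process of transmitters: it is at most \<open>p\<^sup>n\<close> with \<open>n = card W\<close> and
  \<open>p = 1/8 + 1/81 < 1/7\<close>, the hypothesis being far stronger than needed. As there are at most \<open>7\<^sup>m\<close> walks of \<open>m\<close> steps from a given
  square, almost surely only finitely many self-avoiding bad walks have \<open>m\<close> squares and start at
  \<open>(m, 0)\<close>. If all good clusters were finite, the outer boundaries of finite sets of squares would
  provide infinitely many of them.
\<close>

section \<open>Blocking sets in the triangular lattice\<close>

text \<open>The triangular lattice is its own matching lattice: the outer boundary of a connected
  set of squares is connected for the same adjacency, so good clusters and blocking walks live on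
  one graph. That connectedness is obtained from cohomology modulo 2 rather than from planar
  topology.

  Starting the walk of m squares at (m, 0) makes one number record both position and length: a
  boundary around the segment from 0 to n crosses the axis at some m > n and again to the left of 0,
  hence has at least m squares.

  The hypothesis enters through q = (1/3)^((2k+1)^2). As \<open>lamPT\<close> is nonnegative, the
  logarithm must be positive, so q bounds the probability of an empty square, and 2q bounds
  \<open>lamPT\<close> times the area \<open>pi * (RI^2 + rI^2 - overlap)\<close>. At most k^2
  centres of \<open>W\<close> lie in a disk of either radius, so weight 9 per incidence costs at
  most 9^(2k^2) = 3^(4k^2) per primary pair, and q beats this by the factor 3^(-4k-1). This leaves
  (9/8)/9 = 1/8 per square for blocking; 1/81 is a crude bound for emptiness.\<close>

text \<open>Adjacency (made reflexive) in the triangular lattice: the square lattice with one diagonal per face.\<close>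

definition tri_adj :: "int \<times> int \<Rightarrow> int \<times> int \<Rightarrow> bool" where
  "tri_adj u v \<longleftrightarrow> \<bar>fst u - fst v\<bar> \<le> 1 \<and> \<bar>snd u - snd v\<bar> \<le> 1 \<and>
     \<bar>(fst u - fst v) - (snd u - snd v)\<bar> \<le> 1"

definition adj_within :: "(int \<times> int) set \<Rightarrow> ((int \<times> int) \<times> (int \<times> int)) set" where
  "adj_within A = {(u, v). u \<in> A \<and> v \<in> A \<and> tri_adj u v}"

lemma tri_adj_sym: "tri_adj u v \<Longrightarrow> tri_adj v u"
  by (auto simp: tri_adj_def)

lemma tri_adj_refl [simp]: "tri_adj u u"
  by (simp add: tri_adj_def)

lemma sym_adj_within: "sym (adj_within A)"
  by (auto simp: sym_def adj_within_def tri_adj_sym)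

lemma adj_within_rtrancl_sym: "(u, v) \<in> (adj_within A)\<^sup>* \<Longrightarrow> (v, u) \<in> (adj_within A)\<^sup>*"
  using sym_rtrancl[OF sym_adj_within] by (auto dest: symD)

lemma adj_within_rtrancl_mem:
  "(u, v) \<in> (adj_within A)\<^sup>* \<Longrightarrow> u \<in> A \<Longrightarrow> v \<in> A"
  by (induction rule: rtrancl_induct) (auto simp: adj_within_def)

lemma adj_within_rtrancl_invariant:
  assumes "(u, v) \<in> (adj_within A)\<^sup>*"
    and "\<And>a b. a \<in> A \<Longrightarrow> b \<in> A \<Longrightarrow> tri_adj a b \<Longrightarrow> f a = f b"
  shows "f u = f v"
  using assms(1) by (induction rule: rtrancl_induct) (use assms(2) in \<open>auto simp: adj_within_def\<close>)

lemma horizontal_segment_connected: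
  assumes "a \<le> b" "\<And>i. a \<le> i \<Longrightarrow> i \<le> b \<Longrightarrow> (i, y) \<in> A"
  shows "((a, y), (b, y)) \<in> (adj_within A)\<^sup>*"
  using assms
proof (induction b rule: int_ge_induct)
  case (step b)
  have "((b, y), (b + 1, y)) \<in> adj_within A"
    using step by (auto simp: adj_within_def tri_adj_def)
  then show ?case using step by (auto intro: rtrancl_into_rtrancl)
qed auto

lemma vertical_segment_connected:
  assumes "a \<le> b" "\<And>i. a \<le> i \<Longrightarrow> i \<le> b \<Longrightarrow> (x, i) \<in> A"
  shows "((x, a), (x, b)) \<in> (adj_within A)\<^sup>*"
  using assms
proof (induction b rule: int_ge_induct)
  case (step b)
  have "((x, b), (x, b + 1)) \<in> adj_within A"
    using step by (auto simp: adj_within_def tri_adj_def)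
  then show ?case using step by (auto intro: rtrancl_into_rtrancl)
qed auto

section \<open>Cocycles modulo 2 on the triangular lattice\<close>

lemma int_sequence_with_changes:
  fixes e :: "int \<Rightarrow> bool" and c :: bool
  shows "\<exists>h. h 0 = c \<and> (\<forall>x. (h (x + 1) \<noteq> h x) = e x)"
proof -
  \<comment> \<open>The parity of the number of prescribed changes between 0 and \<open>x\<close>; a
    constant added modulo 2 at the end adjusts the value at 0 without affecting the changes.\<close>
  define h where "h x = (if x \<ge> 0 then odd (card {i\<in>{0..<x}. e i}) else odd (card {i\<in>{x..<0}. e i}))" for x
  have ins1: "{i\<in>{0..<x+1}. e i} = (if e x then insert x {i\<in>{0..<x}. e i} else {i\<in>{0..<x}. e i})" if "x \<ge> 0" for x
    using that by (auto simp: le_less)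
  have ins2: "{i\<in>{x..<0}. e i} = (if e x then insert x {i\<in>{x+1..<0}. e i} else {i\<in>{x+1..<0}. e i})" if "x < 0" for x
    using that by auto (metis le_less zless_imp_add1_zle)+
  have "(h (x + 1) \<noteq> h x) = e x" for x
  proof (cases "x \<ge> 0")
    case True
    have "card (insert x {i\<in>{0..<x}. e i}) = Suc (card {i\<in>{0..<x}. e i})"
      by (rule card_insert_disjoint) (auto intro: finite_subset[of _ "{0..<x}"])
    then show ?thesis using True ins1[of x] by (simp add: h_def del: atLeastLessThan_iff)
  next
    case False
    have "card (insert x {i\<in>{x+1..<0}. e i}) = Suc (card {i\<in>{x+1..<0}. e i})"
      by (rule card_insert_disjoint) (auto intro: finite_subset[of _ "{x+1..<0}"])
    then show ?thesis using False ins2[of x]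
      by (cases "x = -1") (simp_all add: h_def del: atLeastLessThan_iff)
  qed
  then have 1: "\<forall>x. (h (x + 1) \<noteq> h x) = e x" by blast
  show ?thesis
    by (rule exI[of _ "\<lambda>x. h x \<noteq> (h 0 \<noteq> c)"]) (use 1 in auto)
qed

text \<open>The first cohomology of the plane modulo 2 vanishes; \<open>\<noteq>\<close> on truth
  values is addition. The potential is summed along the axis and then along every column. Horizontal
  edges off the axis are consistent by induction on the row, because each unit square consists of
  two triangles sharing a diagonal.\<close>

lemma tri_cocycle_is_coboundary:
  assumes sym: "\<And>a b. g a b = g b a"
    and tri: "\<And>a b c. tri_adj a b \<Longrightarrow> tri_adj b c \<Longrightarrow> tri_adj a c \<Longrightarrow> g a c = (g a b \<noteq> g b c)"
  shows "\<exists>f :: int \<times> int \<Rightarrow> bool. \<forall>a b. tri_adj a b \<longrightarrow> (f a \<noteq> f b) = g a b"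
proof -
  obtain h where h': "h 0 = True \<and> (\<forall>x. (h (x + 1) \<noteq> h x) = g (x, 0) (x + 1, 0))"
    using int_sequence_with_changes[of True "\<lambda>x. g (x, 0) (x + 1, 0)"] by (rule exE)
  then have h: "(h (x + 1) \<noteq> h x) = g (x, 0) (x + 1, 0)" for x by (rule spec[OF conjunct2])
  have "\<forall>x. \<exists>v. v 0 = h x \<and> (\<forall>y. (v (y + 1) \<noteq> v y) = g (x, y) (x, y + 1))"
    by (intro allI int_sequence_with_changes)
  from choice[OF this] obtain v
    where v': "\<forall>x. v x 0 = h x \<and> (\<forall>y. (v x (y + 1) \<noteq> v x y) = g (x, y) (x, y + 1))"
    by (rule exE)
  have v0: "v x 0 = h x" for x
    by (rule conjunct1[OF spec[OF v']])
  have v: "(v x (y + 1) \<noteq> v x y) = g (x, y) (x, y + 1)" for x y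
    by (rule spec[OF conjunct2[OF spec[OF v']]])
  have t1: "g (x, y) (x + 1, y + 1) = (g (x, y) (x + 1, y) \<noteq> g (x + 1, y) (x + 1, y + 1))" for x y
    by (rule tri) (auto simp: tri_adj_def)
  have t2: "g (x, y) (x + 1, y + 1) = (g (x, y) (x, y + 1) \<noteq> g (x, y + 1) (x + 1, y + 1))" for x y
    by (rule tri) (auto simp: tri_adj_def)
  have hor: "(v (x + 1) y \<noteq> v x y) = g (x, y) (x + 1, y)" for x y
  proof (induction y rule: int_induct[where k = 0])
    case base
    show ?case unfolding v0 by (rule h)
  next
    case (step1 y)
    show ?case using step1(2) t1[of x y] t2[of x y] v[of x y] v[of "x + 1" y] by blast
  next
    case (step2 y)
    show ?case
      using step2(2) t1[of x "y - 1"] t2[of x "y - 1"] v[of x "y - 1"] v[of "x + 1" "y - 1"]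
      unfolding diff_add_cancel by blast
  qed
  have diag: "(v (x + 1) (y + 1) \<noteq> v x y) = g (x, y) (x + 1, y + 1)" for x y
    using t1[of x y] hor[of x y] v[of "x + 1" y] by blast
  \<comment> \<open>Reflexive adjacency makes \<open>a, a, a\<close> a triangle, so the cocycle
    vanishes on loops.\<close>
  have refl: "\<not> g a a" for a using tri[of a a a] by simp
  define f where "f = (\<lambda>(x, y). v x y)"
  have "(f a \<noteq> f b) = g a b" if "tri_adj a b" for a b
  proof -
    obtain x y x' y' where ab: "a = (x, y)" "b = (x', y')" by fastforce
    have "\<bar>x - x'\<bar> \<le> 1" "\<bar>y - y'\<bar> \<le> 1" "\<bar>(x - x') - (y - y')\<bar> \<le> 1"
      using that unfolding ab tri_adj_def by simp_all
    moreover from this have "x' = x \<or> x' = x + 1 \<or> x = x' + 1" "y' = y \<or> y' = y + 1 \<or> y = y' + 1"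
      by linarith+
    ultimately have "(x' = x \<and> y' = y) \<or> (x' = x + 1 \<and> y' = y) \<or> (x' = x \<and> y' = y + 1) \<or> (x' = x + 1 \<and> y' = y + 1) \<or>
          (x = x' + 1 \<and> y' = y) \<or> (x' = x \<and> y = y' + 1) \<or> (x = x' + 1 \<and> y = y' + 1)"
      by (elim disjE) simp_all
    then show ?thesis
    proof (elim disjE conjE)
      assume "x' = x" "y' = y"
      then show ?thesis using refl[of "(x, y)"] by (simp add: ab)
    next
      assume *: "x' = x + 1" "y' = y"
      show ?thesis using hor[of x y] unfolding ab * f_def prod.case by blast
    next
      assume *: "x' = x" "y' = y + 1"
      show ?thesis using v[of x y] unfolding ab * f_def prod.case by blast
    next
      assume *: "x' = x + 1" "y' = y + 1"
      show ?thesis using diag[of x y] unfolding ab * f_def prod.case by blast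
    next
      assume *: "x = x' + 1" "y' = y"
      show ?thesis using hor[of x' y'] sym[of a b] unfolding ab * f_def prod.case by blast
    next
      assume *: "x' = x" "y = y' + 1"
      show ?thesis using v[of x' y'] sym[of a b] unfolding ab * f_def prod.case by blast
    next
      assume *: "x = x' + 1" "y = y' + 1"
      show ?thesis using diag[of x' y'] sym[of a b] unfolding ab * f_def prod.case by blast
    qed
  qed
  then have "\<forall>a b. tri_adj a b \<longrightarrow> (f a \<noteq> f b) = g a b" by (intro allI impI)
  then show ?thesis by (rule exI[of _ f])
qed

text \<open>If the component \<open>P\<close> of \<open>p\<close> in the boundary \<open>B\<close> of \<open>C\<close> is not all of \<open>B\<close>, the edges between \<open>P\<close> and \<open>C\<close>
  form a cocycle modulo 2, hence a coboundary \<open>\<delta>f\<close>. As \<open>f\<close> is constant on \<open>C\<close> and on \<open>U\<close>, either all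
  edges between \<open>U\<close> and \<open>C\<close> belong to the cocycle or none does.\<close>

lemma outer_boundary_connected:
  assumes C: "\<And>a b. a \<in> C \<Longrightarrow> b \<in> C \<Longrightarrow> (a, b) \<in> (adj_within C)\<^sup>*"
    and U: "\<And>a b. a \<in> U \<Longrightarrow> b \<in> U \<Longrightarrow> (a, b) \<in> (adj_within U)\<^sup>*"
    and disj: "C \<inter> U = {}"
    and closed: "\<And>u v. u \<in> U \<Longrightarrow> tri_adj u v \<Longrightarrow> v \<in> U \<union> C"
    and B: "B = {u \<in> U. \<exists>c\<in>C. tri_adj u c}"
    and "p \<in> B" "q \<in> B"
  shows "(p, q) \<in> (adj_within B)\<^sup>*"
proof (rule ccontr)
  assume npq: "(p, q) \<notin> (adj_within B)\<^sup>*"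
  define P where "P = {u. (p, u) \<in> (adj_within B)\<^sup>*}"
  have PB: "P \<subseteq> B" using \<open>p \<in> B\<close> adj_within_rtrancl_mem unfolding P_def by blast
  have BU: "B \<subseteq> U" using B by auto
  have Pstep: "v \<in> P" if "u \<in> P" "v \<in> B" "tri_adj u v" for u v
  proof -
    have "(u, v) \<in> adj_within B" using that PB by (auto simp: adj_within_def)
    with that(1) show ?thesis by (auto simp: P_def intro: rtrancl_into_rtrancl)
  qed
  have PC: "P \<inter> C = {}" using PB BU disj by auto
  define g where "g a b \<longleftrightarrow> a \<in> P \<and> b \<in> C \<or> a \<in> C \<and> b \<in> P" for a b
  \<comment> \<open>The cocycle condition rests on this: a common neighbour outside \<open>C\<close>
    lies in \<open>U\<close> by closedness, touches \<open>C\<close> and hence lies in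
    \<open>B\<close>, and then belongs to the component \<open>P\<close> of its neighbour. So every
    triangle has an even number of edges between \<open>P\<close> and \<open>C\<close>.\<close>
  have third: "w \<in> P \<or> w \<in> C" if "u \<in> P" "c \<in> C" "tri_adj u w" "tri_adj w c" for u c w
  proof (cases "w \<in> C")
    case False
    then have "w \<in> U" using closed[of u w] that PB BU by auto
    then have "w \<in> B" using that B by auto
    then show ?thesis using Pstep that by auto
  qed auto
  have "\<exists>f :: int \<times> int \<Rightarrow> bool. \<forall>a b. tri_adj a b \<longrightarrow> (f a \<noteq> f b) = g a b"
  proof (rule tri_cocycle_is_coboundary)
    show "g a b = g b a" for a b by (auto simp: g_def)
    show "g a c = (g a b \<noteq> g b c)" if t: "tri_adj a b" "tri_adj b c" "tri_adj a c" for a b c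
    proof -
      note t' = t tri_adj_sym[OF t(1)] tri_adj_sym[OF t(2)] tri_adj_sym[OF t(3)]
      have "\<not> (a \<in> P \<and> a \<in> C)" "\<not> (b \<in> P \<and> b \<in> C)" "\<not> (c \<in> P \<and> c \<in> C)" using PC by blast+
      moreover have "a \<in> P \<and> c \<in> C \<longrightarrow> b \<in> P \<or> b \<in> C" "c \<in> P \<and> a \<in> C \<longrightarrow> b \<in> P \<or> b \<in> C"
        "a \<in> P \<and> b \<in> C \<longrightarrow> c \<in> P \<or> c \<in> C" "b \<in> P \<and> a \<in> C \<longrightarrow> c \<in> P \<or> c \<in> C"
        "b \<in> P \<and> c \<in> C \<longrightarrow> a \<in> P \<or> a \<in> C" "c \<in> P \<and> b \<in> C \<longrightarrow> a \<in> P \<or> a \<in> C"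
        using third t' by blast+
      ultimately show ?thesis
        unfolding g_def by argo
    qed
  qed
  then obtain f :: "int \<times> int \<Rightarrow> bool" where f': "\<forall>a b. tri_adj a b \<longrightarrow> (f a \<noteq> f b) = g a b"
    by (rule exE)
  from this have f: "(f a \<noteq> f b) = g a b" if "tri_adj a b" for a b
    using f' that by blast
  have gC: "\<not> g a b" if "a \<in> C" "b \<in> C" for a b using that PC unfolding g_def by blast
  have gU: "\<not> g a b" if "a \<in> U" "b \<in> U" for a b using that disj unfolding g_def by blast
  have fC: "f a = f b" if "a \<in> C" "b \<in> C" for a b
    by (rule adj_within_rtrancl_invariant[OF C[OF that]]) (use f gC in blast)
  have fU: "f a = f b" if "a \<in> U" "b \<in> U" for a b
    by (rule adj_within_rtrancl_invariant[OF U[OF that]]) (use f gU in blast)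
  obtain c where c: "c \<in> C" "tri_adj p c" using \<open>p \<in> B\<close> B by auto
  obtain c' where c': "c' \<in> C" "tri_adj q c'" using \<open>q \<in> B\<close> B by auto
  have "p \<in> P" "q \<notin> P" "q \<notin> C" using npq \<open>q \<in> B\<close> BU disj by (auto simp: P_def)
  then have "f p \<noteq> f c" "f q = f c'" using f[OF c(2)] f[OF c'(2)] c c' by (auto simp: g_def)
  moreover have "f p = f q" by (rule fU) (use BU \<open>p \<in> B\<close> \<open>q \<in> B\<close> in auto)
  ultimately show False using fC[OF c(1) c'(1)] by auto
qed

section \<open>Self-avoiding paths and bad walks\<close>

lemma adj_within_distinct_path:
  assumes "(p, q) \<in> (adj_within A)\<^sup>*" "p \<in> A"
  shows "\<exists>xs. xs \<noteq> [] \<and> hd xs = p \<and> last xs = q \<and> distinct xs \<and> set xs \<subseteq> A \<and> successively tri_adj xs"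
  using assms
proof (induction rule: converse_rtrancl_induct)
  case base
  then show ?case by (intro exI[of _ "[q]"]) auto
next
  case (step p p')
  then obtain xs where xs: "xs \<noteq> []" "hd xs = p'" "last xs = q" "distinct xs" "set xs \<subseteq> A" "successively tri_adj xs"
    by (auto simp: adj_within_def)
  show ?case
  proof (cases "p \<in> set xs")
    case True
    then obtain ys zs where "xs = ys @ p # zs" by (auto dest: split_list)
    then show ?thesis using xs
      by (intro exI[of _ "p # zs"]) (auto simp: successively_append_iff)
  next
    case False
    then show ?thesis using xs step
      by (intro exI[of _ "p # xs"]) (auto simp: successively_Cons adj_within_def)
  qed
qed

lemma tri_path_length:
  assumes "successively tri_adj xs" "xs \<noteq> []"
  shows "\<bar>fst (hd xs) - fst (last xs)\<bar> < int (length xs)"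
  using assms
proof (induction xs)
  case (Cons x xs)
  then show ?case by (cases "xs = []") (auto simp: successively_Cons tri_adj_def)
qed auto

definition bad_walk :: "(int \<times> int \<Rightarrow> bool) \<Rightarrow> nat \<Rightarrow> (int \<times> int) list \<Rightarrow> bool" where
  "bad_walk bad m xs \<longleftrightarrow> length xs = m \<and> hd xs = (int m, 0) \<and> distinct xs \<and> successively tri_adj xs \<and> (\<forall>z\<in>set xs. bad z)"

text \<open>Take for \<open>C\<close> a segment of the axis together with all good clusters touching it. Its outer boundary
  is bad, connected, and meets the axis on both sides of the segment.\<close>

lemma infinite_cluster_or_bad_walk:
  assumes fin: "\<And>z. finite {w. (z, w) \<in> (adj_within {z. \<not> bad z})\<^sup>*}"
  shows "\<exists>m>n. \<exists>xs. bad_walk bad m xs"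
proof -
  define G where "G = {z. \<not> bad z}"
  define S where "S = (\<lambda>i. (i, 0::int)) ` {0..int n}"
  define K where "K = {w. \<exists>b\<in>S. \<exists>a. tri_adj b a \<and> a \<in> G \<and> (a, w) \<in> (adj_within G)\<^sup>*}"
  define C where "C = S \<union> K"
  have fnb: "finite {a. tri_adj b a}" for b
  proof (rule finite_subset)
    show "{a. tri_adj b a} \<subseteq> {fst b - 1..fst b + 1} \<times> {snd b - 1..snd b + 1}"
      by (auto simp: tri_adj_def)
  qed auto
  have "K \<subseteq> (\<Union>b\<in>S. \<Union>a\<in>{a. tri_adj b a}. {w. (a, w) \<in> (adj_within G)\<^sup>*})"
    by (auto simp: K_def)
  moreover have "finite \<dots>"
    using fin fnb by (auto simp: S_def G_def)
  ultimately have finC: "finite C"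
    by (auto simp: C_def S_def intro: finite_subset)
  have GK: "w \<in> G" if "w \<in> K" for w
    using that adj_within_rtrancl_mem unfolding K_def by blast
  have Kstep: "w \<in> C" if "c \<in> C" "tri_adj c w" "w \<in> G" for c w
  proof (cases "c \<in> S")
    case True
    then have "w \<in> K" using that unfolding K_def by blast
    then show ?thesis by (simp add: C_def)
  next
    case False
    then have "c \<in> K" using that by (auto simp: C_def)
    then obtain b a where *: "b \<in> S" "tri_adj b a" "a \<in> G" "(a, c) \<in> (adj_within G)\<^sup>*"
      by (auto simp: K_def)
    moreover have "(c, w) \<in> adj_within G"
      using GK[OF \<open>c \<in> K\<close>] that by (auto simp: adj_within_def)
    ultimately have "(a, w) \<in> (adj_within G)\<^sup>*" by (auto intro: rtrancl_into_rtrancl)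
    then have "w \<in> K" using * unfolding K_def by blast
    then show ?thesis by (simp add: C_def)
  qed
  have org: "((0, 0), c) \<in> (adj_within C)\<^sup>*" if cC: "c \<in> C" for c
  proof -
    have 1: "((0, 0), b) \<in> (adj_within C)\<^sup>*" if "b \<in> S" for b
      using that horizontal_segment_connected[of 0 "fst b" 0 C] by (auto simp: S_def C_def)
    show ?thesis
    proof (cases "c \<in> S")
      case False
      then obtain b a where *: "b \<in> S" "tri_adj b a" "a \<in> G" "(a, c) \<in> (adj_within G)\<^sup>*"
        using cC unfolding K_def C_def by blast
      have "a \<in> K" using * unfolding K_def by blast
      then have "(b, a) \<in> adj_within C" using * by (auto simp: adj_within_def C_def)
      have "(a, c) \<in> (adj_within C)\<^sup>* \<and> c \<in> C" using *(4)
      proof (induction rule: rtrancl_induct)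
        case base
        then show ?case using \<open>a \<in> K\<close> by (simp add: C_def)
      next
        case (step y z)
        then have "z \<in> C" using Kstep[of y z] by (auto simp: adj_within_def)
        then have "(y, z) \<in> adj_within C" using step by (auto simp: adj_within_def)
        then show ?case using step \<open>z \<in> C\<close> by (auto intro: rtrancl_into_rtrancl)
      qed
      then show ?thesis using 1[OF *(1)] \<open>(b, a) \<in> adj_within C\<close>
        by (meson converse_rtrancl_into_rtrancl rtrancl_trans)
    qed (use 1 in auto)
  qed
  have Cconn: "(a, b) \<in> (adj_within C)\<^sup>*" if "a \<in> C" "b \<in> C" for a b
    using org[OF that(1)] org[OF that(2)] adj_within_rtrancl_sym rtrancl_trans by metis
  obtain R :: int where R: "\<And>c. c \<in> C \<Longrightarrow> \<bar>fst c\<bar> < R \<and> \<bar>snd c\<bar> < R"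
  proof -
    define X where "X = (\<lambda>c. max \<bar>fst c\<bar> \<bar>snd c\<bar>) ` C"
    have X: "finite X" "X \<noteq> {}" using finC by (auto simp: X_def C_def S_def)
    have "\<bar>fst c\<bar> < Max X + 1 \<and> \<bar>snd c\<bar> < Max X + 1" if "c \<in> C" for c
    proof -
      have "max \<bar>fst c\<bar> \<bar>snd c\<bar> \<le> Max X" using X that by (intro Max_ge) (auto simp: X_def)
      then show ?thesis by auto
    qed
    then show ?thesis using that by blast
  qed
  have Rout: "z \<notin> C" if "\<bar>fst z\<bar> \<ge> R \<or> \<bar>snd z\<bar> \<ge> R" for z using R[of z] that by auto
  have SC: "(i, 0) \<in> C" if "0 \<le> i" "i \<le> int n" for i using that by (auto simp: C_def S_def)
  have Rn: "R > int n" "R > 0" using R[OF SC[of "int n"]] by auto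
  define U where "U = {u. ((R, 0), u) \<in> (adj_within (- C))\<^sup>*}"
  have R0: "(R, 0) \<in> - C" using Rout[of "(R, 0)"] Rn(2) by simp
  have UC: "U \<subseteq> - C" using adj_within_rtrancl_mem R0 unfolding U_def by blast
  have Ustep: "v \<in> U" if "u \<in> U" "tri_adj u v" "v \<notin> C" for u v
  proof -
    have "(u, v) \<in> adj_within (- C)" using that UC by (auto simp: adj_within_def)
    then show ?thesis using that by (auto simp: U_def intro: rtrancl_into_rtrancl)
  qed
  have Uconn0: "((R, 0), u) \<in> (adj_within U)\<^sup>*" if "u \<in> U" for u
  proof -
    have "((R, 0), u) \<in> (adj_within (- C))\<^sup>*" using that by (simp add: U_def)
    then show ?thesis
    proof (induction rule: rtrancl_induct)
      case (step y z)
      have "y \<in> U" using step by (simp add: U_def)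
      moreover have "z \<in> U" using step by (simp add: U_def)
      ultimately have "(y, z) \<in> adj_within U" using step by (auto simp: adj_within_def)
      then show ?case using step by (auto intro: rtrancl_into_rtrancl)
    qed auto
  qed
  have Uconn: "(a, b) \<in> (adj_within U)\<^sup>*" if "a \<in> U" "b \<in> U" for a b
    using Uconn0[OF that(1)] Uconn0[OF that(2)] adj_within_rtrancl_sym rtrancl_trans by metis
  have Utrans: "v \<in> U" if "u \<in> U" "(u, v) \<in> (adj_within (- C))\<^sup>*" for u v
    using that by (auto simp: U_def)
  have R0U: "(R, 0) \<in> U" by (auto simp: U_def)
  \<comment> \<open>The upper half of the border of the square of half-width \<open>R\<close> leads
    around \<open>C\<close>, so the far left end of the axis belongs to \<open>U\<close> together
    with the far right end.\<close>
  have "((R, 0), (R, R)) \<in> (adj_within (- C))\<^sup>*"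
    by (rule vertical_segment_connected) (use Rout Rn in auto)
  then have "(R, R) \<in> U" using R0U Utrans by blast
  have "((-R, R), (R, R)) \<in> (adj_within (- C))\<^sup>*"
    by (rule horizontal_segment_connected) (use Rout Rn in auto)
  then have "(-R, R) \<in> U" using \<open>(R, R) \<in> U\<close> Utrans adj_within_rtrancl_sym by blast
  have "((-R, 0), (-R, R)) \<in> (adj_within (- C))\<^sup>*"
    by (rule vertical_segment_connected) (use Rout Rn in auto)
  then have R1U: "(-R, 0) \<in> U" using \<open>(-R, R) \<in> U\<close> Utrans adj_within_rtrancl_sym by blast
  \<comment> \<open>Beyond the extreme points of \<open>C\<close> on the axis, the axis itself
    avoids \<open>C\<close> and connects their outer neighbours to \<open>U\<close>.\<close>
  define X where "X = {i. (i, 0) \<in> C}"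
  have "X = fst ` (C \<inter> {c. snd c = 0})" by (force simp: X_def)
  then have finX: "finite X" using finC by auto
  have X0: "0 \<in> X" "int n \<in> X" using SC by (auto simp: X_def)
  define i where "i = Max X"
  define j where "j = Min X"
  have i: "i \<in> X" "int n \<le> i" "\<And>x. x \<in> X \<Longrightarrow> x \<le> i" using finX X0 Max_in[of X] Max_ge[of X] unfolding i_def by blast+
  have j: "j \<in> X" "j \<le> 0" "\<And>x. x \<in> X \<Longrightarrow> j \<le> x" using finX X0 Min_in[of X] Min_le[of X] unfolding j_def by blast+
  have iR: "i + 1 \<le> R" "-R \<le> j - 1" using i(1) j(1) R[of "(i, 0)"] R[of "(j, 0)"] by (auto simp: X_def)
  have "((i + 1, 0), (R, 0)) \<in> (adj_within (- C))\<^sup>*"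
    by (rule horizontal_segment_connected) (use iR i(3) in \<open>force simp: X_def\<close>)+
  then have iU: "(i + 1, 0) \<in> U" using R0U Utrans adj_within_rtrancl_sym by blast
  have "((-R, 0), (j - 1, 0)) \<in> (adj_within (- C))\<^sup>*"
    by (rule horizontal_segment_connected) (use iR j(3) in \<open>force simp: X_def\<close>)+
  then have jU: "(j - 1, 0) \<in> U" using R1U Utrans by blast
  define B where "B = {u \<in> U. \<exists>c\<in>C. tri_adj u c}"
  have iB: "(i + 1, 0) \<in> B" using iU i(1) by (auto simp: B_def X_def tri_adj_def intro!: bexI[of _ "(i, 0)"])
  have jB: "(j - 1, 0) \<in> B" using jU j(1) by (auto simp: B_def X_def tri_adj_def intro!: bexI[of _ "(j, 0)"])
  have "((i + 1, 0), (j - 1, 0)) \<in> (adj_within B)\<^sup>*"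
    by (rule outer_boundary_connected[OF Cconn Uconn _ _ B_def iB jB]) (use UC Ustep in auto)
  then obtain xs where xs: "xs \<noteq> []" "hd xs = (i + 1, 0)" "last xs = (j - 1, 0)" "distinct xs" "set xs \<subseteq> B"
    "successively tri_adj xs" using adj_within_distinct_path[OF _ iB] by blast
  define m where "m = nat (i + 1)"
  have m: "int m = i + 1" "m > n" using i(2) by (auto simp: m_def)
  \<comment> \<open>As \<open>j \<le> 0\<close>, the path from \<open>(i + 1, 0)\<close> to
    \<open>(j - 1, 0)\<close> crosses at least \<open>i + 2 = m + 1\<close> columns, which is more
    than the \<open>m\<close> squares to be kept.\<close>
  have len: "m \<le> length xs" using tri_path_length[OF xs(6,1)] xs(2,3) m(1) j(2) by auto
  \<comment> \<open>A good square adjacent to \<open>C\<close> would have been absorbed into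
    \<open>C\<close>.\<close>
  have Bbad: "bad z" if zB: "z \<in> B" for z
  proof (rule ccontr)
    assume "\<not> bad z"
    then have "z \<in> G" by (auto simp: G_def)
    moreover obtain c where "c \<in> C" "tri_adj z c" "z \<in> U" using zB unfolding B_def by blast
    ultimately show False using Kstep[of c z] UC tri_adj_sym by blast
  qed
  have "bad_walk bad m (take m xs)"
    unfolding bad_walk_def
  proof (intro conjI ballI)
    show "successively tri_adj (take m xs)"
      using xs(6) successively_append_iff[of tri_adj "take m xs" "drop m xs"] by simp
    show "bad z" if "z \<in> set (take m xs)" for z
      using that xs(5) Bbad by (meson in_set_takeD subsetD)
  qed (use xs len m in \<open>auto simp: hd_take\<close>)
  then show ?thesis using m by blast
qed

text \<open>Self-avoidance is dropped, so prepending a square costs a factor 7 regardless of the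
  past. Finiteness is carried through the induction together with the bound because
  \<open>card\<close> is 0 on infinite sets.\<close>

lemma finite_card_tri_walks:
  "finite {xs. length xs = Suc m \<and> hd xs = p \<and> successively tri_adj xs} \<and>
   card {xs. length xs = Suc m \<and> hd xs = p \<and> successively tri_adj xs} \<le> 7 ^ m"
proof (induction m arbitrary: p)
  case 0
  have "{xs. length xs = Suc 0 \<and> hd xs = p \<and> successively tri_adj xs} = {[p]}"
    by (auto simp: length_Suc_conv)
  then show ?case by simp
next
  case (Suc m)
  define W where "W m p = {xs. length xs = Suc m \<and> hd xs = p \<and> successively tri_adj xs}" for m p
  define nb where "nb = (\<lambda>(a, b). (fst p + a, snd p + b)) ` {(0, 0), (1, 0), (0, 1), (1, 1), (-1, 0), (0, -1), (-1, -1)}"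
  have nb: "v \<in> nb" if "tri_adj p v" for v
  proof -
    define a b where "a = fst v - fst p" and "b = snd v - snd p"
    have "a \<in> {-1, 0, 1}" "b \<in> {-1, 0, 1}" "\<bar>a - b\<bar> \<le> 1"
      using that unfolding tri_adj_def a_def b_def by auto
    then have "(a, b) \<in> {(0, 0), (1, 0), (0, 1), (1, 1), (-1, 0), (0, -1), (-1, -1)}" by auto
    moreover have "v = (\<lambda>(a, b). (fst p + a, snd p + b)) (a, b)" by (simp add: a_def b_def)
    ultimately show ?thesis unfolding nb_def by blast
  qed
  have finnb: "finite nb" unfolding nb_def by simp
  have "card nb \<le> card {(0, 0), (1, 0), (0, 1), (1, 1), (-1, 0), (0, -1), (-1, -1 :: int) :: int \<times> int}"
    unfolding nb_def by (rule card_image_le) simp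
  then have cardnb: "card nb \<le> 7" by simp
  have IH: "finite (W m q)" "card (W m q) \<le> 7 ^ m" for q using Suc[of q] by (auto simp: W_def)
  have sub: "W (Suc m) p \<subseteq> (\<Union>q\<in>nb. (#) p ` W m q)"
  proof
    fix xs assume "xs \<in> W (Suc m) p"
    then obtain ys where ys: "xs = p # ys" "length ys = Suc m" "successively tri_adj (p # ys)"
      by (auto simp: W_def length_Suc_conv)
    then have "tri_adj p (hd ys)" "ys \<in> W m (hd ys)" by (auto simp: successively_Cons W_def)
    then show "xs \<in> (\<Union>q\<in>nb. (#) p ` W m q)" using nb ys by blast
  qed
  have "card (W (Suc m) p) \<le> card (\<Union>q\<in>nb. (#) p ` W m q)"
    using sub finnb IH by (intro card_mono) auto
  also have "\<dots> \<le> (\<Sum>q\<in>nb. card ((#) p ` W m q))" using finnb by (rule card_UN_le)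
  also have "\<dots> \<le> (\<Sum>q\<in>nb. 7 ^ m)"
    by (intro sum_mono order_trans[OF card_image_le] IH)
  also have "\<dots> \<le> 7 ^ Suc m" using cardnb by simp
  finally have "card (W (Suc m) p) \<le> 7 ^ Suc m" .
  moreover have "finite (W (Suc m) p)"
    by (rule finite_subset[OF sub]) (intro finite_UN_I finnb finite_imageI IH(1))
  ultimately show ?case unfolding W_def by (rule conjI[rotated])
qed

section \<open>Poisson processes and independence\<close>

text \<open>Measurability of a count is part of the independence clause, applied to the disjoint
  family that consists of \<open>A\<close> followed by empty sets.\<close>

lemma (in prob_space) poisson_count_measurable:
  assumes "poisson_point_process \<rho> \<Phi>" "A \<in> sets borel" "bounded A"
  shows "(\<lambda>\<omega>. card (\<Phi> \<omega> \<inter> A)) \<in> measurable M (count_space UNIV)"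
proof -
  define F where "F i = (if i = (0::nat) then A else {})" for i
  have "indep_vars (\<lambda>_. count_space UNIV) (\<lambda>i \<omega>. card (\<Phi> \<omega> \<inter> F i)) UNIV"
    using assms unfolding poisson_point_process_def
    by (elim conjE allE[of _ F]) (auto simp: F_def disjoint_family_on_def)
  then have "(\<lambda>\<omega>. card (\<Phi> \<omega> \<inter> F 0)) \<in> measurable M (count_space UNIV)"
    unfolding indep_vars_def by blast
  then show ?thesis by (simp add: F_def)
qed

lemma (in prob_space) poisson_locally_finite:
  assumes "poisson_point_process \<rho> \<Phi>" "\<omega> \<in> space M" "bounded A"
  shows "finite (\<Phi> \<omega> \<inter> A)"
proof -
  have "\<Phi> \<omega> \<in> space point_configs"
    using assms(1,2) unfolding poisson_point_process_def by (auto dest: measurable_space)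
  then show ?thesis using assms(3)
    unfolding point_configs_def by (subst (asm) space_measure_of) auto
qed

text \<open>The process has independent counts along sequences of sets, so the finite family is
  enumerated and padded with empty sets. With values in \<open>ennreal\<close> no integrability has
  to be checked.\<close>

lemma (in prob_space) poisson_nn_integral_prod:
  fixes h :: "'i \<Rightarrow> nat \<Rightarrow> ennreal"
  assumes P: "poisson_point_process \<rho> \<Phi>" and "finite I"
    and B: "\<And>i. i \<in> I \<Longrightarrow> B i \<in> sets borel" "\<And>i. i \<in> I \<Longrightarrow> bounded (B i)"
    and disj: "disjoint_family_on B I"
  shows "(\<integral>\<^sup>+\<omega>. (\<Prod>i\<in>I. h i (card (\<Phi> \<omega> \<inter> B i))) \<partial>M) = (\<Prod>i\<in>I. \<integral>\<^sup>+\<omega>. h i (card (\<Phi> \<omega> \<inter> B i)) \<partial>M)"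
proof -
  obtain e where e: "bij_betw e {0..<card I} I"
    using ex_bij_betw_nat_finite[OF \<open>finite I\<close>] by blast
  define A where "A j = (if j < card I then B (e j) else {})" for j
  have eI: "e j \<in> I" if "j < card I" for j using e that by (auto simp: bij_betw_def)
  have "disjoint_family A"
    unfolding disjoint_family_on_def
  proof (intro ballI impI)
    fix i j :: nat assume "i \<noteq> j"
    show "A i \<inter> A j = {}"
    proof (cases "i < card I \<and> j < card I")
      case True
      then have "e i \<noteq> e j" using e \<open>i \<noteq> j\<close> by (auto simp: bij_betw_def dest: inj_onD)
      then show ?thesis using True disj eI by (auto simp: A_def disjoint_family_on_def)
    qed (auto simp: A_def)
  qed
  then have "indep_vars (\<lambda>_. count_space UNIV) (\<lambda>i \<omega>. card (\<Phi> \<omega> \<inter> A i)) UNIV"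
    using P B eI unfolding poisson_point_process_def by (elim conjE allE[of _ A]) (auto simp: A_def)
  then have "indep_vars (\<lambda>_. borel) (\<lambda>i \<omega>. h (e i) (card (\<Phi> \<omega> \<inter> A i))) {0..<card I}"
    by (rule indep_vars_compose2[OF indep_vars_subset]) auto
  then have "(\<integral>\<^sup>+\<omega>. (\<Prod>i\<in>{0..<card I}. h (e i) (card (\<Phi> \<omega> \<inter> A i))) \<partial>M)
     = (\<Prod>i\<in>{0..<card I}. \<integral>\<^sup>+\<omega>. h (e i) (card (\<Phi> \<omega> \<inter> A i)) \<partial>M)"
    by (intro indep_vars_nn_integral) auto
  also have "(\<lambda>\<omega>. \<Prod>i\<in>{0..<card I}. h (e i) (card (\<Phi> \<omega> \<inter> A i))) = (\<lambda>\<omega>. \<Prod>i\<in>{0..<card I}. h (e i) (card (\<Phi> \<omega> \<inter> B (e i))))"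
    by (auto simp: A_def)
  also have "\<dots> = (\<lambda>\<omega>. \<Prod>i\<in>I. h i (card (\<Phi> \<omega> \<inter> B i)))"
    by (rule ext, rule prod.reindex_bij_betw[OF e])
  also have "(\<Prod>i\<in>{0..<card I}. \<integral>\<^sup>+\<omega>. h (e i) (card (\<Phi> \<omega> \<inter> A i)) \<partial>M) = (\<Prod>i\<in>{0..<card I}. \<integral>\<^sup>+\<omega>. h (e i) (card (\<Phi> \<omega> \<inter> B (e i))) \<partial>M)"
    by (rule prod.cong) (auto simp: A_def)
  also have "\<dots> = (\<Prod>i\<in>I. \<integral>\<^sup>+\<omega>. h i (card (\<Phi> \<omega> \<inter> B i)) \<partial>M)"
    by (rule prod.reindex_bij_betw[OF e])
  finally show ?thesis .
qed

text \<open>The probability generating function of the Poisson law: splitting according to the value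
  of the count produces the exponential series of \<open>z * \<mu>\<close>.\<close>

lemma (in prob_space) poisson_nn_integral_power:
  assumes P: "poisson_point_process \<rho> \<Phi>" and A: "A \<in> sets borel" "bounded A"
    and "\<rho> \<ge> 0" "z \<ge> 0"
  shows "(\<integral>\<^sup>+\<omega>. ennreal z ^ card (\<Phi> \<omega> \<inter> A) \<partial>M) = ennreal (exp (\<rho> * measure lborel A * (z - 1)))"
proof -
  have [measurable]: "(\<lambda>\<omega>. card (\<Phi> \<omega> \<inter> A)) \<in> measurable M (count_space UNIV)"
    by (rule poisson_count_measurable[OF P A])
  define \<mu> where "\<mu> = \<rho> * measure lborel A"
  have mu: "\<mu> \<ge> 0" using \<open>\<rho> \<ge> 0\<close> by (simp add: \<mu>_def)
  have pr: "prob {\<omega> \<in> space M. card (\<Phi> \<omega> \<inter> A) = n} = \<mu> ^ n / fact n * exp (- \<mu>)" for n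
    using P A unfolding poisson_point_process_def \<mu>_def by blast
  have "(\<integral>\<^sup>+\<omega>. ennreal z ^ card (\<Phi> \<omega> \<inter> A) \<partial>M) =
      (\<integral>\<^sup>+\<omega>. (\<Sum>n. ennreal z ^ n * indicator {\<omega> \<in> space M. card (\<Phi> \<omega> \<inter> A) = n} \<omega>) \<partial>M)"
  proof (rule nn_integral_cong)
    fix \<omega> assume "\<omega> \<in> space M"
    have "(\<Sum>n. ennreal z ^ n * indicator {\<omega> \<in> space M. card (\<Phi> \<omega> \<inter> A) = n} \<omega>) =
       (\<Sum>n\<in>{card (\<Phi> \<omega> \<inter> A)}. ennreal z ^ n * indicator {\<omega> \<in> space M. card (\<Phi> \<omega> \<inter> A) = n} \<omega>)"
      by (rule suminf_finite) (auto simp: indicator_def)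
    then show "ennreal z ^ card (\<Phi> \<omega> \<inter> A) = (\<Sum>n. ennreal z ^ n * indicator {\<omega> \<in> space M. card (\<Phi> \<omega> \<inter> A) = n} \<omega>)"
      using \<open>\<omega> \<in> space M\<close> by simp
  qed
  also have "\<dots> = (\<Sum>n. \<integral>\<^sup>+\<omega>. ennreal z ^ n * indicator {\<omega> \<in> space M. card (\<Phi> \<omega> \<inter> A) = n} \<omega> \<partial>M)"
    by (rule nn_integral_suminf) measurable
  also have "\<dots> = (\<Sum>n. ennreal (z ^ n * (\<mu> ^ n / fact n * exp (- \<mu>))))"
    using \<open>z \<ge> 0\<close> mu
    by (intro suminf_cong, subst nn_integral_cmult_indicator)
       (measurable, simp add: emeasure_eq_measure pr ennreal_mult[symmetric] ennreal_power)
  also have "\<dots> = ennreal (exp (\<mu> * (z - 1)))"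
  proof (rule suminf_ennreal_eq)
    have "(\<lambda>n. (z * \<mu>) ^ n /\<^sub>R fact n) sums exp (z * \<mu>)" by (rule exp_converges)
    then have "(\<lambda>n. (z * \<mu>) ^ n /\<^sub>R fact n * exp (- \<mu>)) sums (exp (z * \<mu>) * exp (- \<mu>))"
      by (rule sums_mult2)
    moreover have "exp (z * \<mu>) * exp (- \<mu>) = exp (\<mu> * (z - 1))"
      by (simp add: exp_add[symmetric] algebra_simps)
    ultimately show "(\<lambda>n. z ^ n * (\<mu> ^ n / fact n * exp (- \<mu>))) sums exp (\<mu> * (z - 1))"
      by (simp add: field_simps power_mult_distrib)
  qed (use \<open>z \<ge> 0\<close> mu in auto)
  finally show ?thesis by (simp add: \<mu>_def)
qed

lemma prod_mono_ennreal:
  fixes f g :: "'i \<Rightarrow> ennreal"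
  assumes "\<And>i. i \<in> I \<Longrightarrow> f i \<le> g i"
  shows "prod f I \<le> prod g I"
  using assms by (induction I rule: infinite_finite_induct) (auto intro: mult_mono)

text \<open>\<open>S\<close> is cut into the level sets of \<open>f\<close> at mesh
  \<open>\<delta>\<close>. On each of them \<open>f\<close> is replaced by the upper end of its
  level, which turns the product into powers of independent counts and overshoots \<open>f\<close>
  by at most \<open>\<delta>\<close>.\<close>

lemma (in prob_space) poisson_laplace_upper_step:
  fixes f :: "'b::euclidean_space \<Rightarrow> real"
  assumes P: "poisson_point_process \<rho> \<Phi>" and S: "S \<in> sets borel" "bounded S"
    and f [measurable]: "f \<in> borel_measurable borel" and f0: "\<And>x. f x \<ge> 0"
    and fB: "\<And>x. f x \<le> B" and "\<rho> \<ge> 0" and "\<delta> > 0"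
  shows "(\<integral>\<^sup>+\<omega>. (\<Prod>x\<in>\<Phi> \<omega> \<inter> S. ennreal (1 + f x)) \<partial>M) \<le> exp (\<rho> * ((LINT x|lborel. f x * indicator S x) + \<delta> * measure lborel S))"
proof -
  note [measurable] = S(1)
  define n where "n = nat \<lfloor>B / \<delta>\<rfloor>"
  define lev where "lev x = nat \<lfloor>f x / \<delta>\<rfloor>" for x
  define A where "A i = {x \<in> S. lev x = i}" for i
  have Am [measurable]: "A i \<in> sets borel" for i unfolding A_def lev_def by measurable
  have Ab: "bounded (A i)" for i using S(2) by (rule bounded_subset) (auto simp: A_def)
  have Adisj: "disjoint_family_on A I" for I by (auto simp: disjoint_family_on_def A_def)
  have levn: "lev x \<le> n" for x
    unfolding lev_def n_def using fB[of x] \<open>\<delta> > 0\<close> by (intro nat_mono floor_mono divide_right_mono) auto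
  have levf: "\<delta> * real (lev x) \<le> f x" "f x \<le> \<delta> * real (lev x) + \<delta>" for x
  proof -
    have "f x / \<delta> \<ge> 0" using f0[of x] \<open>\<delta> > 0\<close> by simp
    then have "real (lev x) = of_int \<lfloor>f x / \<delta>\<rfloor>" by (simp add: lev_def)
    then have "real (lev x) \<le> f x / \<delta>" "f x / \<delta> \<le> real (lev x) + 1" by linarith+
    then show "\<delta> * real (lev x) \<le> f x" "f x \<le> \<delta> * real (lev x) + \<delta>"
      using \<open>\<delta> > 0\<close> by (simp_all add: field_simps)
  qed
  have SU: "S = (\<Union>i\<in>{..n}. A i)" using levn by (auto simp: A_def)
  have "(\<integral>\<^sup>+\<omega>. (\<Prod>x\<in>\<Phi> \<omega> \<inter> S. ennreal (1 + f x)) \<partial>M) \<le>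
     (\<integral>\<^sup>+\<omega>. (\<Prod>i\<in>{..n}. ennreal (1 + (\<delta> * i + \<delta>)) ^ card (\<Phi> \<omega> \<inter> A i)) \<partial>M)"
  proof (rule nn_integral_mono)
    fix \<omega> assume "\<omega> \<in> space M"
    then have fin: "finite (\<Phi> \<omega> \<inter> A i)" for i by (rule poisson_locally_finite[OF P _ Ab])
    have "(\<Prod>x\<in>\<Phi> \<omega> \<inter> S. ennreal (1 + f x)) = (\<Prod>x\<in>(\<Union>i\<in>{..n}. \<Phi> \<omega> \<inter> A i). ennreal (1 + f x))"
      using SU by (intro prod.cong) auto
    also have "\<dots> = (\<Prod>i\<in>{..n}. \<Prod>x\<in>\<Phi> \<omega> \<inter> A i. ennreal (1 + f x))"
      by (rule prod.UNION_disjoint) (use fin in \<open>auto simp: A_def\<close>)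
    also have "\<dots> \<le> (\<Prod>i\<in>{..n}. \<Prod>x\<in>\<Phi> \<omega> \<inter> A i. ennreal (1 + (\<delta> * i + \<delta>)))"
      by (intro prod_mono_ennreal) (auto simp: A_def intro!: ennreal_leI levf(2))
    finally show "(\<Prod>x\<in>\<Phi> \<omega> \<inter> S. ennreal (1 + f x)) \<le> (\<Prod>i\<in>{..n}. ennreal (1 + (\<delta> * i + \<delta>)) ^ card (\<Phi> \<omega> \<inter> A i))"
      by simp
  qed
  also have "\<dots> = (\<Prod>i\<in>{..n}. \<integral>\<^sup>+\<omega>. ennreal (1 + (\<delta> * i + \<delta>)) ^ card (\<Phi> \<omega> \<inter> A i) \<partial>M)"
    by (rule poisson_nn_integral_prod[OF P]) (use Ab Adisj in auto)
  also have "\<dots> = (\<Prod>i\<in>{..n}. ennreal (exp (\<rho> * measure lborel (A i) * (\<delta> * i + \<delta>))))"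
    using \<open>\<delta> > 0\<close> \<open>\<rho> \<ge> 0\<close> Ab by (intro prod.cong refl, subst poisson_nn_integral_power[OF P]) auto
  also have "\<dots> = ennreal (exp (\<rho> * (\<Sum>i\<in>{..n}. measure lborel (A i) * (\<delta> * i + \<delta>))))"
    by (simp add: prod_ennreal exp_sum sum_distrib_left mult.assoc)
  also have "\<dots> \<le> exp (\<rho> * ((LINT x|lborel. f x * indicator S x) + \<delta> * measure lborel S))"
  proof (intro ennreal_leI, subst exp_le_cancel_iff, intro mult_left_mono \<open>\<rho> \<ge> 0\<close>)
    have finS: "emeasure lborel C < \<infinity>" if "bounded C" for C :: "'b set"
      using that emeasure_bounded_finite by auto
    have int: "integrable lborel (\<lambda>x. c * indicator (A i) x :: real)" for i c
      using finS[OF Ab[of i]] by (intro integrable_mult_right) (auto simp: integrable_indicator_iff)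
    have intS: "integrable lborel (\<lambda>x. c * indicator S x :: real)" for c
      using finS[OF S(2)] by (intro integrable_mult_right) (auto simp: integrable_indicator_iff)
    have intf: "integrable lborel (\<lambda>x. f x * indicator S x :: real)"
      by (rule Bochner_Integration.integrable_bound[OF intS[of B]])
         (use f0 in \<open>auto simp: indicator_def intro!: AE_I2 order_trans[OF fB abs_ge_self]\<close>)
    have "(\<Sum>i\<in>{..n}. measure lborel (A i) * (\<delta> * i + \<delta>)) = (\<Sum>i\<in>{..n}. (LINT x|lborel. (\<delta> * i + \<delta>) * indicator (A i) x))"
      by (simp add: mult.commute)
    also have "\<dots> = (LINT x|lborel. (\<Sum>i\<in>{..n}. (\<delta> * i + \<delta>) * indicator (A i) x))"
      by (rule Bochner_Integration.integral_sum[symmetric]) (rule int)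
    also have "\<dots> \<le> (LINT x|lborel. f x * indicator S x + \<delta> * indicator S x)"
    proof (rule integral_mono)
      show "(\<Sum>i\<in>{..n}. (\<delta> * real i + \<delta>) * indicator (A i) x) \<le> f x * indicator S x + \<delta> * indicator S x" for x
      proof -
        have "(\<Sum>i\<in>{..n}. (\<delta> * real i + \<delta>) * indicator (A i) x) = (\<Sum>i\<in>{..n}. if i = lev x then (\<delta> * real i + \<delta>) * indicator S x else 0)"
          by (intro sum.cong) (auto simp: A_def indicator_def)
        also have "\<dots> = (\<delta> * real (lev x) + \<delta>) * indicator S x" using levn by simp
        finally show ?thesis using levf(1)[of x] by (auto simp: indicator_def)
      qed
      show "integrable lborel (\<lambda>x. \<Sum>i\<in>{..n}. (\<delta> * real i + \<delta>) * indicator (A i) x)"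
        by (rule Bochner_Integration.integrable_sum) (rule int)
      show "integrable lborel (\<lambda>x. f x * indicator S x + \<delta> * indicator S x)"
        by (rule Bochner_Integration.integrable_add[OF intf intS])
    qed
    also have "\<dots> = (LINT x|lborel. f x * indicator S x) + \<delta> * measure lborel S"
      by (subst Bochner_Integration.integral_add[OF intf intS]) simp
    finally show "(\<Sum>i\<in>{..n}. measure lborel (A i) * (\<delta> * i + \<delta>)) \<le> (LINT x|lborel. f x * indicator S x) + \<delta> * measure lborel S" .
  qed
  finally show ?thesis .
qed

text \<open>The half of Campbell's formula that a moment bound requires; the mesh tends to
  0.\<close>

lemma (in prob_space) poisson_laplace_upper:
  fixes f :: "'b::euclidean_space \<Rightarrow> real"
  assumes P: "poisson_point_process \<rho> \<Phi>" and S: "S \<in> sets borel" "bounded S"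
    and f: "f \<in> borel_measurable borel" "\<And>x. f x \<ge> 0" "\<And>x. f x \<le> B" and "\<rho> \<ge> 0"
  shows "(\<integral>\<^sup>+\<omega>. (\<Prod>x\<in>\<Phi> \<omega> \<inter> S. ennreal (1 + f x)) \<partial>M) \<le> exp (\<rho> * (LINT x|lborel. f x * indicator S x))"
    (is "?L \<le> ennreal (exp (\<rho> * ?I))")
proof (rule tendsto_lowerbound)
  show "((\<lambda>\<delta>. ennreal (exp (\<rho> * (?I + \<delta> * measure lborel S)))) \<longlongrightarrow> ennreal (exp (\<rho> * ?I))) (at_right 0)"
    by (rule tendsto_ennrealI) (auto intro!: tendsto_eq_intros)
  show "\<forall>\<^sub>F \<delta> in at_right 0. ?L \<le> ennreal (exp (\<rho> * (?I + \<delta> * measure lborel S)))"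
    using eventually_at_right_less[of "0::real"]
    by eventually_elim (rule poisson_laplace_upper_step[OF assms])
qed simp

text \<open>Independence makes the joint law a product measure, so Tonelli applies. The second
  variable \<open>\<omega>'\<close> resamples \<open>X\<close> while \<open>Y\<close> stays fixed,
  which is conditioning on \<open>Y\<close>.\<close>

lemma (in prob_space) indep_elements_nn_integral:
  assumes I: "indep_elements MX X MY Y" and h: "h \<in> borel_measurable (MX \<Otimes>\<^sub>M MY)"
  shows "(\<integral>\<^sup>+\<omega>. h (X \<omega>, Y \<omega>) \<partial>M) = (\<integral>\<^sup>+\<omega>. \<integral>\<^sup>+\<omega>'. h (X \<omega>', Y \<omega>) \<partial>M \<partial>M)"
proof -
  have X [measurable]: "X \<in> measurable M MX" and Y [measurable]: "Y \<in> measurable M MY"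
    using I by (auto simp: indep_elements_def)
  interpret DX: prob_space "distr M MX X" by (rule prob_space_distr) (rule X)
  interpret DY: prob_space "distr M MY Y" by (rule prob_space_distr) (rule Y)
  interpret PD: pair_prob_space "distr M MX X" "distr M MY Y" ..
  have eq: "distr M MX X \<Otimes>\<^sub>M distr M MY Y = distr M (MX \<Otimes>\<^sub>M MY) (\<lambda>\<omega>. (X \<omega>, Y \<omega>))"
  proof (rule pair_measure_eqI)
    fix A B assume "A \<in> sets (distr M MX X)" "B \<in> sets (distr M MY Y)"
    then have AB [measurable]: "A \<in> sets MX" "B \<in> sets MY" by auto
    have "prob ((X -` A \<inter> space M) \<inter> (Y -` B \<inter> space M)) = prob (X -` A \<inter> space M) * prob (Y -` B \<inter> space M)"
      using I AB unfolding indep_elements_def by (intro indep_setD) (auto intro: in_vimage_algebra)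
    moreover have "(X -` A \<inter> space M) \<inter> (Y -` B \<inter> space M) = (\<lambda>\<omega>. (X \<omega>, Y \<omega>)) -` (A \<times> B) \<inter> space M" by auto
    ultimately show "emeasure (distr M MX X) A * emeasure (distr M MY Y) B =
       emeasure (distr M (MX \<Otimes>\<^sub>M MY) (\<lambda>\<omega>. (X \<omega>, Y \<omega>))) (A \<times> B)"
      by (simp add: emeasure_distr emeasure_eq_measure ennreal_mult)
  qed (auto intro: DX.sigma_finite_measure DY.sigma_finite_measure sets_pair_measure_cong)
  have h' [measurable]: "h \<in> borel_measurable (distr M MX X \<Otimes>\<^sub>M distr M MY Y)"
    using h by (simp cong: measurable_cong_sets sets_pair_measure_cong)
  have "(\<integral>\<^sup>+\<omega>. h (X \<omega>, Y \<omega>) \<partial>M) = (\<integral>\<^sup>+p. h p \<partial>distr M (MX \<Otimes>\<^sub>M MY) (\<lambda>\<omega>. (X \<omega>, Y \<omega>)))"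
    using h by (subst nn_integral_distr) auto
  also have "\<dots> = (\<integral>\<^sup>+y. \<integral>\<^sup>+x. h (x, y) \<partial>distr M MX X \<partial>distr M MY Y)"
    unfolding eq[symmetric] by (rule PD.nn_integral_snd[symmetric]) simp
  also have "\<dots> = (\<integral>\<^sup>+\<omega>. \<integral>\<^sup>+x. h (x, Y \<omega>) \<partial>distr M MX X \<partial>M)"
  proof (rule nn_integral_distr)
    have "(\<lambda>(y, x). h (x, y)) \<in> borel_measurable (distr M MY Y \<Otimes>\<^sub>M distr M MX X)"
      using measurable_compose[OF measurable_pair_swap' h'] by (simp add: case_prod_beta')
    then show "(\<lambda>y. \<integral>\<^sup>+x. h (x, y) \<partial>distr M MX X) \<in> borel_measurable (distr M MY Y)"
      by (rule DX.borel_measurable_nn_integral)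
  qed simp
  also have "\<dots> = (\<integral>\<^sup>+\<omega>. \<integral>\<^sup>+\<omega>'. h (X \<omega>', Y \<omega>) \<partial>M \<partial>M)"
  proof (rule nn_integral_cong)
    fix \<omega> assume "\<omega> \<in> space M"
    then have "Y \<omega> \<in> space MY" by (rule measurable_space[OF Y])
    then have "(\<lambda>x. h (x, Y \<omega>)) \<in> borel_measurable MX" using h by simp
    then show "(\<integral>\<^sup>+x. h (x, Y \<omega>) \<partial>distr M MX X) = (\<integral>\<^sup>+\<omega>'. h (X \<omega>', Y \<omega>) \<partial>M)"
      by (subst nn_integral_distr) auto
  qed
  finally show ?thesis .
qed

lemma (in prob_space) indep_elements_prob:
  assumes I: "indep_elements MX X MY Y" and AB: "A \<in> sets MX" "B \<in> sets MY"
  shows "prob {\<omega> \<in> space M. X \<omega> \<in> A \<and> Y \<omega> \<in> B} = prob {\<omega> \<in> space M. X \<omega> \<in> A} * prob {\<omega> \<in> space M. Y \<omega> \<in> B}"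
proof -
  have "prob ((X -` A \<inter> space M) \<inter> (Y -` B \<inter> space M)) = prob (X -` A \<inter> space M) * prob (Y -` B \<inter> space M)"
    using I AB unfolding indep_elements_def by (intro indep_setD) (auto intro: in_vimage_algebra)
  moreover have "(X -` A \<inter> space M) \<inter> (Y -` B \<inter> space M) = {\<omega> \<in> space M. X \<omega> \<in> A \<and> Y \<omega> \<in> B}"
    "X -` A \<inter> space M = {\<omega> \<in> space M. X \<omega> \<in> A}" "Y -` B \<inter> space M = {\<omega> \<in> space M. Y \<omega> \<in> B}" by auto
  ultimately show ?thesis by simp
qed

lemma emeasure_cball_real2:
  fixes c :: "real^2"
  assumes "r \<ge> 0"
  shows "emeasure lborel (cball c r) = ennreal (pi * r\<^sup>2)"
  using assms by (simp add: emeasure_cball unit_ball_vol_2)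

lemma measure_cball_real2:
  fixes c :: "real^2"
  assumes "r \<ge> 0"
  shows "measure lborel (cball c r) = pi * r\<^sup>2"
  using assms by (simp add: measure_def emeasure_cball_real2)

text \<open>After exchanging the integrals, the inner one is the area of a translate of the disk for
  every displacement. Hence receivers contribute the same area as undisplaced points, whatever the
  law \<open>\<nu>\<close>.\<close>

lemma nn_integral_displaced_cball:
  fixes c :: "real^2"
  assumes "prob_space \<nu>" and [measurable_cong]: "sets \<nu> = sets borel" and "r \<ge> 0"
  shows "(\<integral>\<^sup>+t. \<integral>\<^sup>+d. indicator (cball c r) (t + d) \<partial>\<nu> \<partial>lborel) = ennreal (pi * r\<^sup>2)"
proof -
  interpret nu: prob_space \<nu> by fact
  interpret P: pair_sigma_finite lborel \<nu>
    by (intro pair_sigma_finite.intro lborel.sigma_finite_measure_axioms nu.sigma_finite_measure_axioms)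
  have "(\<integral>\<^sup>+t. \<integral>\<^sup>+d. indicator (cball c r) (t + d) \<partial>\<nu> \<partial>lborel) = (\<integral>\<^sup>+d. \<integral>\<^sup>+t. indicator (cball c r) (t + d) \<partial>lborel \<partial>\<nu>)"
    by (rule P.Fubini'[symmetric]) (unfold indicator_def mem_cball case_prod_beta', measurable)
  also have "\<dots> = (\<integral>\<^sup>+d. \<integral>\<^sup>+t. indicator (cball (c - d) r) t \<partial>lborel \<partial>\<nu>)"
    by (intro nn_integral_cong) (simp add: indicator_def dist_norm algebra_simps)
  also have "\<dots> = (\<integral>\<^sup>+d. ennreal (pi * r\<^sup>2) \<partial>\<nu>)"
    using \<open>r \<ge> 0\<close> by (simp add: emeasure_cball_real2)
  also have "\<dots> = ennreal (pi * r\<^sup>2)" by (simp add: nu.emeasure_space_1)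
  finally show ?thesis .
qed

text \<open>The primary data form one argument, so that blocking becomes a measurable event of the
  single random element that \<open>secondary_indep_primary\<close> makes independent of the
  users.\<close>

definition blocked :: "real \<Rightarrow> real \<Rightarrow> real^2 \<Rightarrow> enat \<times> (nat \<Rightarrow> real^2) \<times> (nat \<Rightarrow> real^2) \<Rightarrow> bool" where
  "blocked r1 r2 a = (\<lambda>(m, t, d). \<exists>n. enat n < m \<and> (dist a (t n) \<le> r1 \<or> dist a (t n + d n) \<le> r2))"

lemma blocked_measurable [measurable]:
  "Measurable.pred (count_space UNIV \<Otimes>\<^sub>M PiM UNIV (\<lambda>_. borel) \<Otimes>\<^sub>M PiM UNIV (\<lambda>_. borel)) (blocked r1 r2 a)"
  unfolding blocked_def case_prod_beta' by measurable

lemma prod_if_eq_power_card: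
  "finite W \<Longrightarrow> (\<Prod>z\<in>W. if P z then b else 1) = (b :: real) ^ card {z \<in> W. P z}"
  by (simp add: prod.If_cases Int_def)

section \<open>Blocking by primary users\<close>

text \<open>Makes an exponential weight additive in the number \<open>g\<close> of incidences, given
  only an upper bound \<open>L\<close> for it. The linear term has to be effective from
  \<open>g = 1\<close> on, and \<open>g = 0\<close> is exact.\<close>

lemma power_le_one_plus_linear:
  fixes b :: real
  assumes "b \<ge> 1" "g \<le> L"
  shows "b ^ g \<le> 1 + b ^ L * real g"
proof (cases "g = 0")
  case False
  have "b ^ g \<le> b ^ L" using assms by (simp add: power_increasing)
  also have "\<dots> \<le> b ^ L * real g" using False assms by (intro mult_le_cancel_left1[THEN iffD2]) (auto simp: Suc_le_eq)
  finally show ?thesis by simp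
qed simp

lemma (in heterogeneous_network) measurable_primary:
  "(\<lambda>\<omega>. (N \<omega>, \<lambda>n. T n \<omega>, \<lambda>n. D n \<omega>)) \<in> measurable M (count_space UNIV \<Otimes>\<^sub>M PiM UNIV (\<lambda>_. borel) \<Otimes>\<^sub>M PiM UNIV (\<lambda>_. borel))"
  using secondary_indep_primary by (simp add: indep_elements_def)

text \<open>Exponential Markov inequality for the number of incidences between points \<open>c z\<close> and pairs
  blocking them: conditionally on the transmitters the displacements factor out, and the remaining
  product over the transmitters is a Laplace functional.\<close>

lemma (in heterogeneous_network) primary_blocking_bound:
  fixes c :: "'i \<Rightarrow> real^2" and b :: real
  assumes W: "finite W" and r: "r1 > 0" "r2 > 0" and Rp: "Rp > 0" and lam: "lamPT \<ge> 0" and b: "b \<ge> 1"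
    and n1: "\<And>x. card {z \<in> W. dist (c z) x \<le> r1} \<le> n1"
    and n2: "\<And>x. card {z \<in> W. dist (c z) x \<le> r2} \<le> n2"
  shows "b ^ card W * prob {\<omega> \<in> space M. \<forall>z\<in>W. blocked r1 r2 (c z) (N \<omega>, \<lambda>n. T n \<omega>, \<lambda>n. D n \<omega>)}
     \<le> exp (lamPT * (b ^ (n1 + n2) * (card W * (pi * r1\<^sup>2 + pi * r2\<^sup>2))))"
proof -
  define X where "X \<omega> = (\<lambda>n. D n \<omega>)" for \<omega>
  define Y where "Y \<omega> = (N \<omega>, \<lambda>n. T n \<omega>)" for \<omega>
  have Ym [measurable]: "Y \<in> measurable M (count_space UNIV \<Otimes>\<^sub>M PiM UNIV (\<lambda>_. borel))"
    using displacements_indep_transmitters unfolding indep_elements_def Y_def by simp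
  have Nm [measurable]: "N \<in> measurable M (count_space UNIV)"
    using measurable_compose[OF Ym measurable_fst] by (simp add: Y_def)
  have Tm [measurable]: "T n \<in> borel_measurable M" for n
    using measurable_compose[OF measurable_compose[OF Ym measurable_snd] measurable_component_singleton[of n UNIV]]
    by (simp add: Y_def)
  have Dm [measurable]: "D n \<in> borel_measurable M" for n
    using displacement_indep by (auto simp: indep_vars_def)
  define \<nu> where "\<nu> = (uniform_measure lborel (cball 0 Rp) :: (real^2) measure)"
  have nu: "prob_space \<nu>" unfolding \<nu>_def
    using Rp by (intro prob_space_uniform_measure) (auto simp: emeasure_cball_real2)
  then interpret nu: prob_space \<nu> .
  have sets_nu [measurable_cong]: "sets \<nu> = sets borel" by (simp add: \<nu>_def)
  have distr_D: "distr M borel (D n) = \<nu>" for n by (simp add: displacement_uniform \<nu>_def)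
  \<comment> \<open>Transmitter and receiver are counted separately, so that \<open>F\<close> is
    exactly \<open>b\<close> to the number of incidences of one pair.\<close>
  define G where "G z t d = (if dist (c z) t \<le> r1 then b else 1) * (if dist (c z) (t + d) \<le> r2 then b else 1)"
    for z and t d :: "real^2"
  define F where "F t d = (\<Prod>z\<in>W. G z t d)" for t d
  have G1: "G z t d \<ge> 1" for z t d using b mult_mono[of 1 b 1 b] by (auto simp: G_def)
  have F1: "F t d \<ge> 1" for t d unfolding F_def using G1 by (intro prod_ge_1) auto
  have Fm [measurable]: "(\<lambda>(t, d). F t d) \<in> borel_measurable (borel \<Otimes>\<^sub>M borel)"
    unfolding F_def G_def case_prod_beta' by measurable
  define Q where "Q = b ^ (n1 + n2)"
  have Q: "Q \<ge> 0" using b by (simp add: Q_def)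
  define u where "u z t = (\<integral>\<^sup>+d. indicator (cball (c z) r2) (t + d) \<partial>\<nu>)" for z t
  have um [measurable]: "u z \<in> borel_measurable borel" for z
    unfolding u_def by (rule nu.borel_measurable_nn_integral) (unfold indicator_def mem_cball case_prod_beta', measurable)
  have u1: "u z t \<le> 1" for z t
  proof -
    have "u z t \<le> (\<integral>\<^sup>+d. 1 \<partial>\<nu>)" unfolding u_def by (intro nn_integral_mono) (auto simp: indicator_def)
    then show ?thesis by (simp add: nu.emeasure_space_1)
  qed
  \<comment> \<open>\<open>f t\<close> dominates the mean excess over 1 of the weight of a pair
    whose transmitter is at \<open>t\<close>; \<open>u z t\<close> is the probability that its
    receiver comes within \<open>r2\<close> of \<open>c z\<close>.\<close>
  define f where "f t = Q * (\<Sum>z\<in>W. indicator (cball (c z) r1) t + enn2real (u z t))" for t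
  have fm [measurable]: "f \<in> borel_measurable borel"
    unfolding f_def indicator_def mem_cball by measurable
  have f0: "f t \<ge> 0" for t using Q by (auto simp: f_def intro!: mult_nonneg_nonneg sum_nonneg)
  have fB: "f t \<le> Q * (\<Sum>z\<in>W. 2)" for t
  proof -
    have "indicator (cball (c z) r1) t + enn2real (u z t) \<le> 2" for z
      using enn2real_mono[OF u1[of z t]] by (simp add: indicator_def)
    then show ?thesis unfolding f_def using Q by (intro mult_left_mono sum_mono)
  qed
  have ef: "ennreal (f t) = ennreal Q * (\<Sum>z\<in>W. indicator (cball (c z) r1) t + u z t)" for t
  proof -
    have "ennreal (indicator (cball (c z) r1) t + enn2real (u z t)) = indicator (cball (c z) r1) t + u z t" for z
      using u1[of z t] by (subst ennreal_plus) (auto simp: ennreal_indicator order_le_less_trans)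
    then show ?thesis
      unfolding f_def using Q by (subst ennreal_mult) (auto intro!: sum_nonneg simp: sum_ennreal[symmetric])
  qed
  \<comment> \<open>Linearising before averaging over \<open>d\<close> leaves a sum of indicators,
    whose averages are known.\<close>
  have intF: "(\<integral>\<^sup>+d. ennreal (F t d) \<partial>\<nu>) \<le> ennreal (1 + f t)" for t
  proof -
    have "ennreal (F t d) \<le> 1 + ennreal Q * (\<Sum>z\<in>W. indicator (cball (c z) r1) t + indicator (cball (c z) r2) (t + d))" for d
    proof -
      have "F t d = b ^ (card {z \<in> W. dist (c z) t \<le> r1} + card {z \<in> W. dist (c z) (t + d) \<le> r2})"
        unfolding F_def G_def prod.distrib prod_if_eq_power_card[OF W] power_add ..
      also have "\<dots> \<le> 1 + Q * real (card {z \<in> W. dist (c z) t \<le> r1} + card {z \<in> W. dist (c z) (t + d) \<le> r2})"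
        unfolding Q_def using n1[of t] n2[of "t + d"] by (intro power_le_one_plus_linear b add_mono)
      finally have "ennreal (F t d) \<le> 1 + ennreal Q * of_nat (card {z \<in> W. dist (c z) t \<le> r1} + card {z \<in> W. dist (c z) (t + d) \<le> r2})"
        using Q by (simp add: ennreal_leI ennreal_mult'[symmetric] ennreal_of_nat_eq_real_of_nat
            flip: ennreal_1 ennreal_plus)
      moreover have "of_nat (card {z \<in> W. P z}) = (\<Sum>z\<in>W. if P z then 1 else 0 :: ennreal)" for P
        using W by (simp add: sum.If_cases Int_def)
      ultimately show ?thesis by (simp add: sum.distrib indicator_def of_bool_def)
    qed
    then have "(\<integral>\<^sup>+d. ennreal (F t d) \<partial>\<nu>) \<le>
      (\<integral>\<^sup>+d. 1 + ennreal Q * (\<Sum>z\<in>W. indicator (cball (c z) r1) t + indicator (cball (c z) r2) (t + d)) \<partial>\<nu>)"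
      by (intro nn_integral_mono)
    also have "\<dots> = 1 + ennreal Q * (\<Sum>z\<in>W. indicator (cball (c z) r1) t + u z t)"
    proof -
      have [measurable]: "(\<lambda>d. indicator (cball (c z) r2) (t + d) :: ennreal) \<in> borel_measurable \<nu>" for z
        unfolding indicator_def mem_cball by measurable
      show ?thesis
        unfolding u_def
        by (simp add: nn_integral_add nn_integral_cmult nn_integral_sum nu.emeasure_space_1)
    qed
    also have "\<dots> = ennreal (1 + f t)" unfolding ef[symmetric] using f0 by simp
    finally show ?thesis .
  qed
  \<comment> \<open>Displacements are almost surely at most \<open>Rp\<close> long, so
    \<open>f\<close> vanishes off a bounded set, as the Laplace functional demands.\<close>
  define S where "S = (\<Union>z\<in>W. cball (c z) (r1 + r2 + Rp))"
  have S: "S \<in> sets borel" "bounded S" unfolding S_def using W by auto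
  have fS: "f t = 0" if "t \<notin> S" for t
  proof -
    have far: "dist (c z) t > r1 + r2 + Rp" if "z \<in> W" for z using \<open>t \<notin> S\<close> that by (auto simp: S_def)
    have "u z t = 0" if "z \<in> W" for z
    proof -
      have "AE d in \<nu>. d \<in> cball 0 Rp"
        unfolding \<nu>_def by (rule AE_uniform_measureI) auto
      then have "AE d in \<nu>. indicator (cball (c z) r2) (t + d) = (0::ennreal)"
      proof eventually_elim
        case (elim d)
        have "dist (c z) t \<le> dist (c z) (t + d) + norm d"
          using norm_triangle_ineq[of "c z - (t + d)" d] by (simp add: dist_norm)
        then have "dist (c z) (t + d) > r2" using far[OF that] elim r by (simp add: dist_norm)
        then show ?case by (simp add: indicator_def)
      qed
      then have "u z t = (\<integral>\<^sup>+d. 0 \<partial>\<nu>)" unfolding u_def by (rule nn_integral_cong_AE)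
      then show ?thesis by simp
    qed
    moreover have "indicator (cball (c z) r1) t = (0::real)" if "z \<in> W" for z
      using far[OF that] r Rp by (auto simp: indicator_def)
    ultimately show ?thesis by (simp add: f_def)
  qed
  have intf: "(LINT t|lborel. f t * indicator S t) \<le> Q * (card W * (pi * r1\<^sup>2 + pi * r2\<^sup>2))"
  proof -
    have "(\<integral>\<^sup>+t. ennreal (f t * indicator S t) \<partial>lborel) = (\<integral>\<^sup>+t. ennreal (f t) \<partial>lborel)"
      using fS by (intro nn_integral_cong) (auto simp: indicator_def)
    also have "\<dots> = ennreal Q * (\<Sum>z\<in>W. (\<integral>\<^sup>+t. indicator (cball (c z) r1) t \<partial>lborel) + (\<integral>\<^sup>+t. u z t \<partial>lborel))"
    proof -
      have "cball (c z) r1 \<in> sets borel" for z by (intro borel_closed closed_cball)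
      then have m: "(indicator (cball (c z) r1) :: _ \<Rightarrow> ennreal) \<in> borel_measurable lborel" "u z \<in> borel_measurable lborel" for z
        using um[of z] borel_measurable_indicator[of "cball (c z) r1" lborel] by simp_all
      have "(\<lambda>t. indicator (cball (c z) r1) t + u z t) \<in> borel_measurable lborel" for z
        by (intro borel_measurable_add m)
      then show ?thesis
        unfolding ef using m by (simp add: nn_integral_cmult nn_integral_sum nn_integral_add borel_measurable_sum)
    qed
    also have "\<dots> = ennreal Q * (\<Sum>z\<in>W. ennreal (pi * r1\<^sup>2) + ennreal (pi * r2\<^sup>2))"
      unfolding u_def using r by (simp add: nn_integral_displaced_cball[OF nu sets_nu] emeasure_cball_real2)
    also have "\<dots> = ennreal Q * (\<Sum>z\<in>W. ennreal (pi * r1\<^sup>2 + pi * r2\<^sup>2))"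
      by (subst ennreal_plus) auto
    also have "\<dots> = ennreal Q * ennreal (\<Sum>z\<in>W. pi * r1\<^sup>2 + pi * r2\<^sup>2)"
      by (subst sum_ennreal) auto
    also have "\<dots> = ennreal (Q * (card W * (pi * r1\<^sup>2 + pi * r2\<^sup>2)))"
      by (subst ennreal_mult'[OF Q, symmetric]) simp
    finally have "(\<integral>\<^sup>+t. ennreal (f t * indicator S t) \<partial>lborel) = ennreal (Q * (card W * (pi * r1\<^sup>2 + pi * r2\<^sup>2)))" .
    then have "(LINT t|lborel. f t * indicator S t) = Q * (card W * (pi * r1\<^sup>2 + pi * r2\<^sup>2))"
      using f0 Q S(1) by (subst integral_eq_nn_integral) auto
    then show ?thesis by simp
  qed
  \<comment> \<open>Cutting the enumeration at \<open>j\<close> gives a finite product that the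
    independent displacements factorise. All factors are at least 1, so \<open>H\<close> increases
    in \<open>j\<close> and monotone convergence restores all pairs.\<close>
  define H where "H j \<omega> = (\<Prod>n<j. if enat n < N \<omega> then ennreal (F (T n \<omega>) (D n \<omega>)) else 1)" for j \<omega>
  have [measurable]: "Measurable.pred (count_space UNIV) (\<lambda>m. enat n < m)" for n by simp
  have Hm [measurable]: "H j \<in> borel_measurable M" for j
    unfolding H_def by measurable
  have HE: "(\<integral>\<^sup>+\<omega>. H j \<omega> \<partial>M) \<le> ennreal (exp (lamPT * (Q * (card W * (pi * r1\<^sup>2 + pi * r2\<^sup>2)))))" for j
  proof -
    define hh where "hh = (\<lambda>(d :: nat \<Rightarrow> real^2, m :: enat, t :: nat \<Rightarrow> real^2). \<Prod>n<j. if enat n < m then ennreal (F (t n) (d n)) else 1)"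
    have hhm: "hh \<in> borel_measurable (PiM UNIV (\<lambda>_. borel) \<Otimes>\<^sub>M count_space UNIV \<Otimes>\<^sub>M PiM UNIV (\<lambda>_. borel))"
      unfolding hh_def case_prod_beta' by measurable
    have "(\<integral>\<^sup>+\<omega>. H j \<omega> \<partial>M) = (\<integral>\<^sup>+\<omega>. hh (X \<omega>, Y \<omega>) \<partial>M)"
      by (simp add: H_def hh_def X_def Y_def)
    also have "\<dots> = (\<integral>\<^sup>+\<omega>. \<integral>\<^sup>+\<omega>'. hh (X \<omega>', Y \<omega>) \<partial>M \<partial>M)"
      using displacements_indep_transmitters hhm unfolding X_def Y_def by (rule indep_elements_nn_integral)
    also have "\<dots> \<le> (\<integral>\<^sup>+\<omega>. (\<Prod>x\<in>transmitters N T \<omega> \<inter> S. ennreal (1 + f x)) \<partial>M)"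
    proof (rule nn_integral_mono)
      fix \<omega> assume \<omega>: "\<omega> \<in> space M"
      have "(\<integral>\<^sup>+\<omega>'. hh (X \<omega>', Y \<omega>) \<partial>M) = (\<integral>\<^sup>+\<omega>'. (\<Prod>n<j. if enat n < N \<omega> then ennreal (F (T n \<omega>) (D n \<omega>')) else 1) \<partial>M)"
        by (simp add: hh_def X_def Y_def)
      also have "\<dots> = (\<Prod>n<j. \<integral>\<^sup>+\<omega>'. (if enat n < N \<omega> then ennreal (F (T n \<omega>) (D n \<omega>')) else 1) \<partial>M)"
      proof (rule indep_vars_nn_integral)
        have "indep_vars (\<lambda>_. borel) D {..<j}" by (rule indep_vars_subset[OF displacement_indep]) simp
        then show "indep_vars (\<lambda>_. borel) (\<lambda>n \<omega>'. if enat n < N \<omega> then ennreal (F (T n \<omega>) (D n \<omega>')) else 1) {..<j}"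
          by (rule indep_vars_compose2[where Y = "\<lambda>n d. if enat n < N \<omega> then ennreal (F (T n \<omega>) d) else 1"]) measurable
      qed auto
      also have "\<dots> \<le> (\<Prod>n<j. if enat n < N \<omega> then ennreal (1 + f (T n \<omega>)) else 1)"
      proof (rule prod_mono_ennreal)
        fix n
        have "(\<integral>\<^sup>+\<omega>'. ennreal (F (T n \<omega>) (D n \<omega>')) \<partial>M) = (\<integral>\<^sup>+d. ennreal (F (T n \<omega>) d) \<partial>\<nu>)"
          unfolding distr_D[of n, symmetric] by (rule nn_integral_distr[symmetric]) measurable
        also have "\<dots> \<le> ennreal (1 + f (T n \<omega>))" by (rule intF)
        finally show "(\<integral>\<^sup>+\<omega>'. (if enat n < N \<omega> then ennreal (F (T n \<omega>) (D n \<omega>')) else 1) \<partial>M)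
            \<le> (if enat n < N \<omega> then ennreal (1 + f (T n \<omega>)) else 1)"
          by (simp add: emeasure_space_1)
      qed
      also have "\<dots> = (\<Prod>n\<in>{n. n < j \<and> enat n < N \<omega>}. ennreal (1 + f (T n \<omega>)))"
        by (simp add: prod.If_cases Int_def)
      \<comment> \<open>An enumeration without repetition turns the product over indices into a
        product over points of the configuration.\<close>
      also have "\<dots> = (\<Prod>x\<in>(\<lambda>n. T n \<omega>) ` {n. n < j \<and> enat n < N \<omega>}. ennreal (1 + f x))"
        by (rule prod.reindex_cong[symmetric, OF _ refl refl]) (rule inj_on_subset[OF enumeration_inj[OF \<omega>]], auto)
      also have "\<dots> = (\<Prod>x\<in>(\<lambda>n. T n \<omega>) ` {n. n < j \<and> enat n < N \<omega>} \<inter> S. ennreal (1 + f x))"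
        by (rule prod.mono_neutral_right) (auto simp: fS)
      also have "\<dots> \<le> (\<Prod>x\<in>transmitters N T \<omega> \<inter> S. ennreal (1 + f x))"
      proof -
        have fin: "finite (transmitters N T \<omega> \<inter> S)"
          by (rule poisson_locally_finite[OF primary_transmitters \<omega> S(2)])
        have sub: "(\<lambda>n. T n \<omega>) ` {n. n < j \<and> enat n < N \<omega>} \<inter> S \<subseteq> transmitters N T \<omega> \<inter> S"
          by (auto simp: transmitters_def)
        have "(\<Prod>x\<in>(\<lambda>n. T n \<omega>) ` {n. n < j \<and> enat n < N \<omega>} \<inter> S. 1 + f x) \<le> (\<Prod>x\<in>transmitters N T \<omega> \<inter> S. 1 + f x)"
          by (rule prod_mono2[OF fin sub]) (use f0 in \<open>auto intro: add_nonneg_nonneg\<close>)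
        moreover have "(\<Prod>x\<in>I. ennreal (1 + f x)) = ennreal (\<Prod>x\<in>I. 1 + f x)" for I
          by (rule prod_ennreal) (use f0 in \<open>auto intro: add_nonneg_nonneg\<close>)
        ultimately show ?thesis by (simp only: ennreal_leI)
      qed
      finally show "(\<integral>\<^sup>+\<omega>'. hh (X \<omega>', Y \<omega>) \<partial>M) \<le> (\<Prod>x\<in>transmitters N T \<omega> \<inter> S. ennreal (1 + f x))" .
    qed
    also have "\<dots> \<le> ennreal (exp (lamPT * (LINT x|lborel. f x * indicator S x)))"
      by (rule poisson_laplace_upper[OF primary_transmitters S fm f0 fB lam])
    also have "\<dots> \<le> ennreal (exp (lamPT * (Q * (card W * (pi * r1\<^sup>2 + pi * r2\<^sup>2)))))"
      using intf lam by (auto intro!: ennreal_leI mult_left_mono)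
    finally show ?thesis .
  qed
  define A where "A = {\<omega> \<in> space M. \<forall>z\<in>W. blocked r1 r2 (c z) (N \<omega>, \<lambda>n. T n \<omega>, \<lambda>n. D n \<omega>)}"
  have Am [measurable]: "A \<in> events"
    unfolding A_def using W measurable_compose[OF measurable_primary blocked_measurable] by (auto intro!: sets.sets_Collect_finite_All')
  \<comment> \<open>Each blocked centre receives a factor \<open>b\<close> from some pair. Pairs
    shared by several centres do no harm, since \<open>F\<close> multiplies over centres, and
    finiteness of \<open>W\<close> gives one \<open>j\<close> beyond all the pairs used.\<close>
  have key: "ennreal (b ^ card W) * indicator A \<omega> \<le> (SUP j. H j \<omega>)" if "\<omega> \<in> space M" for \<omega>
  proof (cases "\<omega> \<in> A")
    case True
    then have "\<forall>z\<in>W. \<exists>n. enat n < N \<omega> \<and> (dist (c z) (T n \<omega>) \<le> r1 \<or> dist (c z) (T n \<omega> + D n \<omega>) \<le> r2)"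
      by (auto simp: A_def blocked_def)
    from bchoice[OF this] obtain m :: "'i \<Rightarrow> nat" where m: "\<And>z. z \<in> W \<Longrightarrow> enat (m z) < N \<omega>"
      "\<And>z. z \<in> W \<Longrightarrow> dist (c z) (T (m z) \<omega>) \<le> r1 \<or> dist (c z) (T (m z) \<omega> + D (m z) \<omega>) \<le> r2"
      by blast
    obtain j where j: "\<And>z. z \<in> W \<Longrightarrow> m z < j"
    proof -
      have "finite (m ` W)" using W by simp
      then obtain k where "\<forall>x\<in>m ` W. x \<le> k" using finite_nat_set_iff_bounded_le[of "m ` W"] by blast
      then show ?thesis by (intro that[of "Suc k"]) auto
    qed
    define g where "g z n = (if enat n < N \<omega> then G z (T n \<omega>) (D n \<omega>) else 1)" for z n
    have g1: "g z n \<ge> 1" for z n using G1 by (simp add: g_def)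
    have "b \<le> (\<Prod>n<j. g z n)" if "z \<in> W" for z
    proof -
      have "b \<le> g z (m z)" using m[OF that] b mult_mono[of 1 b b b] by (auto simp: g_def G_def)
      also have "\<dots> = (\<Prod>n\<in>{m z}. g z n)" by simp
      also have "\<dots> \<le> (\<Prod>n<j. g z n)"
        using j[OF that] by (intro prod_mono2) (auto intro: g1 order_trans[OF _ g1])
      finally show ?thesis .
    qed
    then have "(\<Prod>z\<in>W. b) \<le> (\<Prod>z\<in>W. \<Prod>n<j. g z n)" using b by (intro prod_mono) auto
    also have "\<dots> = (\<Prod>n<j. \<Prod>z\<in>W. g z n)" by (rule prod.swap)
    also have "\<dots> = (\<Prod>n<j. if enat n < N \<omega> then F (T n \<omega>) (D n \<omega>) else 1)"
      by (intro prod.cong) (auto simp: g_def F_def)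
    finally have "ennreal (b ^ card W) \<le> ennreal (\<Prod>n<j. if enat n < N \<omega> then F (T n \<omega>) (D n \<omega>) else 1)"
      by (simp add: ennreal_leI)
    also have "\<dots> = (\<Prod>n<j. ennreal (if enat n < N \<omega> then F (T n \<omega>) (D n \<omega>) else 1))"
      using F1 by (intro prod_ennreal[symmetric]) (auto intro: order_trans[of 0 1])
    also have "\<dots> = H j \<omega>" unfolding H_def by (intro prod.cong) auto
    also have "\<dots> \<le> (SUP j. H j \<omega>)" by (rule SUP_upper) simp
    finally show ?thesis using True by simp
  qed simp
  have "ennreal (b ^ card W * prob A) = (\<integral>\<^sup>+\<omega>. ennreal (b ^ card W) * indicator A \<omega> \<partial>M)"
    using b by (simp add: nn_integral_cmult_indicator emeasure_eq_measure ennreal_mult)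
  also have "\<dots> \<le> (\<integral>\<^sup>+\<omega>. (SUP j. H j \<omega>) \<partial>M)" by (intro nn_integral_mono key)
  also have "\<dots> = (SUP j. \<integral>\<^sup>+\<omega>. H j \<omega> \<partial>M)"
  proof (rule nn_integral_monotone_convergence_SUP)
    show "incseq H"
    proof (intro incseq_SucI le_funI)
      fix j \<omega>
      have "H j \<omega> * 1 \<le> H j \<omega> * (if enat j < N \<omega> then ennreal (F (T j \<omega>) (D j \<omega>)) else 1)"
        using F1 by (intro mult_left_mono) auto
      then show "H j \<omega> \<le> H (Suc j) \<omega>" by (simp add: H_def)
    qed
  qed simp
  also have "\<dots> \<le> ennreal (exp (lamPT * (Q * (card W * (pi * r1\<^sup>2 + pi * r2\<^sup>2)))))"
    by (rule SUP_least) (rule HE)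
  finally show ?thesis by (simp add: A_def Q_def)
qed

section \<open>Cells\<close>

definition cell :: "real \<Rightarrow> int \<times> int \<Rightarrow> (real^2) set" where
  "cell s z = {p. s * of_int (fst z) \<le> p $ 1 \<and> p $ 1 < s * of_int (fst z + 1) \<and>
                  s * of_int (snd z) \<le> p $ 2 \<and> p $ 2 < s * of_int (snd z + 1)}"

lemma cell_subset_cbox:
  "cell s z \<subseteq> cbox (vector [s * of_int (fst z), s * of_int (snd z)]) (vector [s * of_int (fst z + 1), s * of_int (snd z + 1)])"
  by (auto simp: cell_def mem_box_cart forall_2)

lemma box_subset_cell:
  "box (vector [s * of_int (fst z), s * of_int (snd z)]) (vector [s * of_int (fst z + 1), s * of_int (snd z + 1)]) \<subseteq> cell s z"
  by (auto simp: cell_def mem_box_cart forall_2)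

lemma cell_borel [measurable, simp]: "cell s z \<in> sets borel"
  unfolding cell_def by measurable

lemma bounded_cell [simp]: "bounded (cell s z)"
  by (rule bounded_subset[OF bounded_cbox cell_subset_cbox])

text \<open>A lower bound is what limits the probability of an empty square; it comes from the open
  box inside.\<close>

lemma measure_cell_ge:
  assumes "s > 0"
  shows "s\<^sup>2 \<le> measure lborel (cell s z)"
proof -
  define a b :: "real^2" where "a = vector [s * of_int (fst z), s * of_int (snd z)]"
    and "b = vector [s * of_int (fst z + 1), s * of_int (snd z + 1)]"
  have le: "a $ i \<le> b $ i" for i using assms by (cases i rule: exhaust_2[THEN disjE]) (auto simp: a_def b_def)
  then have ne: "cbox a b \<noteq> {}" by (auto simp: interval_ne_empty_cart)
  have "s\<^sup>2 = measure lborel (cbox a b)"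
    unfolding content_cbox_cart[OF ne] by (simp add: prod_2 UNIV_2 a_def b_def power2_eq_square algebra_simps)
  also have "\<dots> = measure lborel (box a b)"
    by (simp add: measure_lborel_box_eq measure_lborel_cbox_eq)
  also have "\<dots> \<le> measure lborel (cell s z)"
    unfolding a_def b_def
    by (rule measure_mono_fmeasurable[OF box_subset_cell])
       (use emeasure_bounded_finite[OF bounded_cell[of s z]] in \<open>auto simp: fmeasurable_def\<close>)
  finally show ?thesis .
qed

text \<open>Used twice: for the independence of the counts in different squares, and for the
  injectivity of a choice of one user per square.\<close>

lemma cell_disjoint:
  assumes "s > 0" "z \<noteq> z'"
  shows "cell s z \<inter> cell s z' = {}"
proof (rule ccontr)
  assume "cell s z \<inter> cell s z' \<noteq> {}"
  then obtain p where p: "p \<in> cell s z" "p \<in> cell s z'" by auto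
  have eq: "i = j" if "s * of_int i \<le> x" "x < s * of_int (i + 1)" "s * of_int j \<le> x" "x < s * of_int (j + 1)" for i j :: int and x
  proof -
    have "s * of_int i < s * of_int (j + 1)" "s * of_int j < s * of_int (i + 1)" using that by linarith+
    then have "i < j + 1" "j < i + 1" using \<open>s > 0\<close> by (simp_all only: mult_less_cancel_left_pos of_int_less_iff)
    then show ?thesis by simp
  qed
  have "fst z = fst z'" "snd z = snd z'" using p unfolding cell_def by (auto intro: eq)
  then show False using \<open>z \<noteq> z'\<close> by (simp add: prod_eq_iff)
qed

text \<open>Hitting \<open>B\<close> is the complement of the count being 0. Local finiteness
  excludes the value 0 that \<open>card\<close> takes on infinite sets.\<close>

lemma hit_event_in_point_configs:
  assumes "B \<in> sets borel" "bounded B"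
  shows "{X \<in> space point_configs. X \<inter> B \<noteq> {}} \<in> sets point_configs"
proof -
  let ?G = "{{X. (\<forall>B. bounded B \<longrightarrow> finite (X \<inter> B)) \<and> card (X \<inter> A) = n} | A n. A \<in> sets borel \<and> bounded A} :: 'a set set set"
  let ?S = "{X. \<forall>B. bounded B \<longrightarrow> finite (X \<inter> B)} :: 'a set set"
  have G: "?G \<subseteq> Pow ?S" by auto
  have sp: "space point_configs = ?S" unfolding point_configs_def by (rule space_measure_of) (rule G)
  have "{X. (\<forall>B. bounded B \<longrightarrow> finite (X \<inter> B)) \<and> card (X \<inter> B) = 0} \<in> sets point_configs"
    unfolding point_configs_def using assms by (subst sets_measure_of[OF G]) (auto intro: sigma_sets.Basic)
  then have "space point_configs - {X. (\<forall>B. bounded B \<longrightarrow> finite (X \<inter> B)) \<and> card (X \<inter> B) = 0} \<in> sets point_configs"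
    by (rule sets.compl_sets)
  also have "space point_configs - {X. (\<forall>B. bounded B \<longrightarrow> finite (X \<inter> B)) \<and> card (X \<inter> B) = 0} =
      {X \<in> space point_configs. X \<inter> B \<noteq> {}}"
    unfolding sp using assms(2) by auto
  finally show ?thesis .
qed

lemma measurable_find:
  assumes "\<And>c. c \<in> set cs \<Longrightarrow> {x \<in> space M. P x c} \<in> sets M"
  shows "(\<lambda>x. find (P x) cs) \<in> measurable M (count_space UNIV)"
  using assms
proof (induction cs)
  case (Cons c cs)
  have "(\<lambda>x. if P x c then Some c else find (P x) cs) \<in> measurable M (count_space UNIV)"
    using Cons by (intro measurable_If) auto
  then show ?case by simp
qed auto

text \<open>Working with centres from a finite list avoids a measurable selection of a point.\<close>

definition pick :: "real \<Rightarrow> real \<Rightarrow> (int \<times> int \<Rightarrow> (real^2) list) \<Rightarrow> int \<times> int \<Rightarrow> (real^2) set \<Rightarrow> (real^2) option" where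
  "pick s \<delta> cs z X = find (\<lambda>c. X \<inter> (cell s z \<inter> cball c \<delta>) \<noteq> {}) (cs z)"

lemma pick_measurable: "pick s \<delta> cs z \<in> measurable point_configs (count_space UNIV)"
  unfolding pick_def by (intro measurable_find hit_event_in_point_configs) (auto simp: borel_closed)

lemma pick_None_iff:
  assumes "cell s z \<subseteq> (\<Union>c\<in>set (cs z). cball c \<delta>)"
  shows "pick s \<delta> cs z X = None \<longleftrightarrow> X \<inter> cell s z = {}"
  using assms unfolding pick_def find_None_iff by blast

lemma pick_SomeD:
  assumes "pick s \<delta> cs z X = Some c"
  shows "c \<in> set (cs z)" "X \<inter> (cell s z \<inter> cball c \<delta>) \<noteq> {}"
  using assms unfolding pick_def find_Some_iff by auto

text \<open>A square without users picks \<open>None\<close> and is bad vacuously, so emptiness and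
  blocking are covered by one condition.\<close>

definition site_bad ::
  "real \<Rightarrow> real \<Rightarrow> (int \<times> int \<Rightarrow> (real^2) list) \<Rightarrow> real \<Rightarrow> real \<Rightarrow> int \<times> int \<Rightarrow> (real^2) set \<Rightarrow>
     enat \<times> (nat \<Rightarrow> real^2) \<times> (nat \<Rightarrow> real^2) \<Rightarrow> bool" where
  "site_bad s \<delta> cs r1 r2 z X p \<longleftrightarrow> (\<forall>c. pick s \<delta> cs z X = Some c \<longrightarrow> blocked r1 r2 c p)"

lemma (in heterogeneous_network) measurable_secondary: "SU \<in> measurable M point_configs"
  using secondary_indep_primary by (simp add: indep_elements_def)

lemma (in heterogeneous_network) site_bad_event:
  "{\<omega> \<in> space M. site_bad s \<delta> cs r1 r2 z (SU \<omega>) (N \<omega>, \<lambda>n. T n \<omega>, \<lambda>n. D n \<omega>)} \<in> events"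
proof -
  have p: "(\<lambda>\<omega>. pick s \<delta> cs z (SU \<omega>)) \<in> measurable M (count_space UNIV)"
    by (rule measurable_compose[OF measurable_secondary pick_measurable])
  have [measurable]: "Measurable.pred M (\<lambda>\<omega>. pick s \<delta> cs z (SU \<omega>) = Some c)" for c
    by (rule measurable_compose[OF p]) simp
  have [measurable]: "Measurable.pred M (\<lambda>\<omega>. blocked r1 r2 c (N \<omega>, \<lambda>n. T n \<omega>, \<lambda>n. D n \<omega>))" for c
    by (rule measurable_compose[OF measurable_primary blocked_measurable])
  \<comment> \<open>Picks come from the finite list of the square, so the quantifier over the plane
    becomes a finite one.\<close>
  have "{\<omega> \<in> space M. site_bad s \<delta> cs r1 r2 z (SU \<omega>) (N \<omega>, \<lambda>n. T n \<omega>, \<lambda>n. D n \<omega>)} =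
    {\<omega> \<in> space M. \<forall>c\<in>set (cs z). pick s \<delta> cs z (SU \<omega>) = Some c \<longrightarrow> blocked r1 r2 c (N \<omega>, \<lambda>n. T n \<omega>, \<lambda>n. D n \<omega>)}"
    unfolding site_bad_def using pick_SomeD(1) by blast
  also have "\<dots> \<in> events" by measurable
  finally show ?thesis .
qed

text \<open>The event is split according to the finitely many patterns of picks on \<open>W\<close>.
  A pattern depends on the users only, so by independence the primary users contribute
  \<open>\<beta>\<close> for each occupied square. Summing over patterns gives the mean of
  \<open>\<beta>\<close> to the number of occupied squares, which factorises over the disjoint
  squares.\<close>

lemma (in heterogeneous_network) site_bad_bound:
  assumes W: "finite W" and s: "s > 0" and \<beta>: "0 \<le> \<beta>" "\<beta> \<le> 1"
    and cover: "\<And>z. cell s z \<subseteq> (\<Union>c\<in>set (cs z). cball c \<delta>)"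
    and block: "\<And>V c. finite V \<Longrightarrow> (\<And>z. z \<in> V \<Longrightarrow> c z \<in> set (cs z)) \<Longrightarrow>
       prob {\<omega> \<in> space M. \<forall>z\<in>V. blocked r1 r2 (c z) (N \<omega>, \<lambda>n. T n \<omega>, \<lambda>n. D n \<omega>)} \<le> \<beta> ^ card V"
    and lamS: "lamS \<ge> 0"
  shows "prob {\<omega> \<in> space M. \<forall>z\<in>W. site_bad s \<delta> cs r1 r2 z (SU \<omega>) (N \<omega>, \<lambda>n. T n \<omega>, \<lambda>n. D n \<omega>)}
     \<le> (exp (- (lamS * s\<^sup>2)) + \<beta>) ^ card W" (is "prob ?A \<le> _")
proof -
  define Y where "Y \<omega> = (N \<omega>, \<lambda>n. T n \<omega>, \<lambda>n. D n \<omega>)" for \<omega>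
  define Fs where "Fs = PiE W (\<lambda>z. insert None (Some ` set (cs z)))"
  have finFs: "finite Fs" unfolding Fs_def using W by (intro finite_PiE) auto
  define A1 where "A1 f = {X \<in> space point_configs. \<forall>z\<in>W. pick s \<delta> cs z X = f z}" for f
  define B1 where "B1 f = {p \<in> space (count_space UNIV \<Otimes>\<^sub>M PiM UNIV (\<lambda>_. borel) \<Otimes>\<^sub>M PiM UNIV (\<lambda>_. borel)).
     \<forall>z\<in>{z \<in> W. f z \<noteq> None}. blocked r1 r2 (the (f z)) p}" for f :: "int \<times> int \<Rightarrow> (real^2) option"
  have A1: "A1 f \<in> sets point_configs" for f
    unfolding A1_def
  proof (rule sets.sets_Collect_finite_All[OF _ W])
    show "{X \<in> space point_configs. pick s \<delta> cs z X = f z} \<in> sets point_configs" for z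
      using measurable_sets[OF pick_measurable[of s \<delta> cs z], of "{f z}"]
      by (simp add: vimage_def Int_def conj_commute)
  qed
  have B1: "B1 f \<in> sets (count_space UNIV \<Otimes>\<^sub>M PiM UNIV (\<lambda>_. borel) \<Otimes>\<^sub>M PiM UNIV (\<lambda>_. borel))" for f
    unfolding B1_def using W by (intro sets.sets_Collect_finite_All) (auto intro!: predE)
  have Yspace: "Y \<omega> \<in> space (count_space UNIV \<Otimes>\<^sub>M PiM UNIV (\<lambda>_. borel) \<Otimes>\<^sub>M PiM UNIV (\<lambda>_. borel))" if "\<omega> \<in> space M" for \<omega>
    unfolding Y_def by (rule measurable_space[OF measurable_primary that])
  have Sspace: "SU \<omega> \<in> space point_configs" if "\<omega> \<in> space M" for \<omega>
    by (rule measurable_space[OF measurable_secondary that])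
  define E where "E f = {\<omega> \<in> space M. SU \<omega> \<in> A1 f}" for f
  have Em [measurable]: "E f \<in> events" for f
    unfolding E_def using measurable_sets[OF measurable_secondary A1[of f]] by (simp add: vimage_def Int_def conj_commute)
  define E2 where "E2 f = {\<omega> \<in> space M. SU \<omega> \<in> A1 f \<and> Y \<omega> \<in> B1 f}" for f
  have E2m: "E2 f \<in> events" for f
  proof -
    have "{\<omega> \<in> space M. Y \<omega> \<in> B1 f} \<in> events"
      using measurable_sets[OF measurable_primary B1[of f]] by (simp add: vimage_def Int_def conj_commute Y_def)
    moreover have "E2 f = E f \<inter> {\<omega> \<in> space M. Y \<omega> \<in> B1 f}" by (auto simp: E2_def E_def)
    ultimately show ?thesis using Em by auto
  qed
  have "?A \<subseteq> (\<Union>f\<in>Fs. E2 f)"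
  proof
    fix \<omega> assume w: "\<omega> \<in> ?A"
    define f where "f = restrict (\<lambda>z. pick s \<delta> cs z (SU \<omega>)) W"
    have "pick s \<delta> cs z (SU \<omega>) \<in> insert None (Some ` set (cs z))" for z
      by (cases "pick s \<delta> cs z (SU \<omega>)") (auto dest: pick_SomeD)
    then have "f \<in> Fs" by (auto simp: Fs_def f_def)
    moreover have "\<omega> \<in> E2 f"
      using w Yspace[of \<omega>] Sspace[of \<omega>] by (auto simp: E2_def A1_def B1_def f_def site_bad_def Y_def)
    ultimately show "\<omega> \<in> (\<Union>f\<in>Fs. E2 f)" by blast
  qed
  then have "prob ?A \<le> prob (\<Union>f\<in>Fs. E2 f)"
    using finFs E2m by (intro finite_measure_mono) auto
  also have "\<dots> \<le> (\<Sum>f\<in>Fs. prob (E2 f))"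
    using finFs E2m by (intro measure_UNION_le) auto
  also have "\<dots> \<le> (\<Sum>f\<in>Fs. prob (E f) * \<beta> ^ card {z \<in> W. f z \<noteq> None})"
  proof (rule sum_mono)
    fix f assume "f \<in> Fs"
    have "prob (E2 f) = prob (E f) * prob {\<omega> \<in> space M. Y \<omega> \<in> B1 f}"
      unfolding E2_def E_def Y_def by (rule indep_elements_prob[OF secondary_indep_primary A1 B1])
    also have "{\<omega> \<in> space M. Y \<omega> \<in> B1 f} = {\<omega> \<in> space M. \<forall>z\<in>{z \<in> W. f z \<noteq> None}. blocked r1 r2 (the (f z)) (Y \<omega>)}"
      using Yspace by (auto simp: B1_def)
    also have "prob \<dots> \<le> \<beta> ^ card {z \<in> W. f z \<noteq> None}"
      unfolding Y_def
    proof (rule block)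
      fix z assume z: "z \<in> {z \<in> W. f z \<noteq> None}"
      then have "f z \<in> insert None (Some ` set (cs z))" using \<open>f \<in> Fs\<close> unfolding Fs_def by (blast dest: PiE_mem)
      then show "the (f z) \<in> set (cs z)" using z by auto
    qed (use W in auto)
    finally show "prob (E2 f) \<le> prob (E f) * \<beta> ^ card {z \<in> W. f z \<noteq> None}" by (simp add: mult_left_mono)
  qed
  finally have 1: "prob ?A \<le> (\<Sum>f\<in>Fs. prob (E f) * \<beta> ^ card {z \<in> W. f z \<noteq> None})" .
  \<comment> \<open>The weight of a square depends only on its number of users, which is the form to
    which independence of counts applies.\<close>
  define h where "h n = (if n = 0 then 1 else ennreal \<beta>)" for n :: nat
  have "ennreal (\<Sum>f\<in>Fs. prob (E f) * \<beta> ^ card {z \<in> W. f z \<noteq> None}) = (\<Sum>f\<in>Fs. ennreal (\<beta> ^ card {z \<in> W. f z \<noteq> None}) * emeasure M (E f))"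
    using \<beta> by (subst sum_ennreal[symmetric]) (auto simp: emeasure_eq_measure ennreal_mult mult.commute)
  also have "\<dots> = (\<Sum>f\<in>Fs. \<integral>\<^sup>+\<omega>. ennreal (\<beta> ^ card {z \<in> W. f z \<noteq> None}) * indicator (E f) \<omega> \<partial>M)"
    by (simp add: nn_integral_cmult_indicator)
  also have "\<dots> = (\<integral>\<^sup>+\<omega>. (\<Sum>f\<in>Fs. ennreal (\<beta> ^ card {z \<in> W. f z \<noteq> None}) * indicator (E f) \<omega>) \<partial>M)"
    by (rule nn_integral_sum[symmetric]) measurable
  also have "\<dots> \<le> (\<integral>\<^sup>+\<omega>. (\<Prod>z\<in>W. h (card (SU \<omega> \<inter> cell s z))) \<partial>M)"
  proof (rule nn_integral_mono)
    fix \<omega> assume \<omega>: "\<omega> \<in> space M"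
    \<comment> \<open>\<open>g\<close> is the pattern realised at \<open>\<omega>\<close>, so at
      most one summand is nonzero.\<close>
    define g where "g = restrict (\<lambda>z. pick s \<delta> cs z (SU \<omega>)) W"
    have eqg: "f = g" if "f \<in> Fs" "\<omega> \<in> E f" for f
    proof (rule extensionalityI[of f W])
      show "f \<in> extensional W" using that(1) by (auto simp: Fs_def PiE_def)
      show "g \<in> extensional W" by (simp add: g_def)
      show "f z = g z" if "z \<in> W" for z using \<open>\<omega> \<in> E f\<close> that by (simp add: E_def A1_def g_def)
    qed
    have "(\<Sum>f\<in>Fs. ennreal (\<beta> ^ card {z \<in> W. f z \<noteq> None}) * indicator (E f) \<omega>) \<le> (\<Sum>f\<in>Fs. if f = g then ennreal (\<beta> ^ card {z \<in> W. g z \<noteq> None}) else 0)"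
    proof (rule sum_mono)
      fix f assume "f \<in> Fs"
      show "ennreal (\<beta> ^ card {z \<in> W. f z \<noteq> None}) * indicator (E f) \<omega> \<le> (if f = g then ennreal (\<beta> ^ card {z \<in> W. g z \<noteq> None}) else 0)"
      proof (cases "\<omega> \<in> E f")
        case True
        then have "f = g" by (rule eqg[OF \<open>f \<in> Fs\<close>])
        then show ?thesis by (simp add: indicator_def)
      qed simp
    qed
    also have "\<dots> \<le> ennreal (\<beta> ^ card {z \<in> W. g z \<noteq> None})" using finFs by simp
    also have "\<dots> = ennreal (\<Prod>z\<in>W. if g z \<noteq> None then \<beta> else 1)" by (simp only: prod_if_eq_power_card[OF W])
    also have "\<dots> = (\<Prod>z\<in>W. ennreal (if g z \<noteq> None then \<beta> else 1))"
      using \<beta> by (intro prod_ennreal[symmetric]) auto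
    also have "\<dots> = (\<Prod>z\<in>W. h (card (SU \<omega> \<inter> cell s z)))"
    proof (rule prod.cong)
      fix z assume "z \<in> W"
      have "finite (SU \<omega> \<inter> cell s z)" by (rule poisson_locally_finite[OF secondary_users \<omega>]) simp
      then have "card (SU \<omega> \<inter> cell s z) = 0 \<longleftrightarrow> g z = None"
        using pick_None_iff[where s = s and z = z and cs = cs and \<delta> = \<delta> and X = "SU \<omega>", OF cover] \<open>z \<in> W\<close> by (simp add: g_def)
      then show "ennreal (if g z \<noteq> None then \<beta> else 1) = h (card (SU \<omega> \<inter> cell s z))" by (auto simp: h_def)
    qed simp
    finally show "(\<Sum>f\<in>Fs. ennreal (\<beta> ^ card {z \<in> W. f z \<noteq> None}) * indicator (E f) \<omega>) \<le> (\<Prod>z\<in>W. h (card (SU \<omega> \<inter> cell s z)))" .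
  qed
  also have "\<dots> = (\<Prod>z\<in>W. \<integral>\<^sup>+\<omega>. h (card (SU \<omega> \<inter> cell s z)) \<partial>M)"
    using cell_disjoint[OF s] by (intro poisson_nn_integral_prod[OF secondary_users W]) (auto simp: disjoint_family_on_def)
  also have "\<dots> \<le> (\<Prod>z\<in>W. ennreal (exp (- (lamS * s\<^sup>2)) + \<beta>))"
  proof (rule prod_mono_ennreal)
    fix z
    have [measurable]: "(\<lambda>\<omega>. card (SU \<omega> \<inter> cell s z)) \<in> measurable M (count_space UNIV)"
      by (rule poisson_count_measurable[OF secondary_users]) auto
    have "(\<integral>\<^sup>+\<omega>. h (card (SU \<omega> \<inter> cell s z)) \<partial>M) \<le> (\<integral>\<^sup>+\<omega>. indicator {\<omega> \<in> space M. card (SU \<omega> \<inter> cell s z) = 0} \<omega> + ennreal \<beta> \<partial>M)"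
      by (intro nn_integral_mono) (auto simp: h_def indicator_def)
    also have "\<dots> = ennreal (prob {\<omega> \<in> space M. card (SU \<omega> \<inter> cell s z) = 0}) + ennreal \<beta>"
      by (subst nn_integral_add) (auto simp: emeasure_eq_measure prob_space)
    also have "prob {\<omega> \<in> space M. card (SU \<omega> \<inter> cell s z) = 0} = exp (- (lamS * measure lborel (cell s z)))"
    proof -
      have "prob {\<omega> \<in> space M. card (SU \<omega> \<inter> cell s z) = 0} = (lamS * measure lborel (cell s z)) ^ 0 / fact 0 * exp (- (lamS * measure lborel (cell s z)))"
        using secondary_users unfolding poisson_point_process_def by auto
      then show ?thesis by simp
    qed
    also have "ennreal (exp (- (lamS * measure lborel (cell s z)))) + ennreal \<beta> \<le> ennreal (exp (- (lamS * s\<^sup>2)) + \<beta>)"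
      using measure_cell_ge[OF s, of z] lamS \<beta> by (simp flip: ennreal_plus add: ennreal_leI mult_left_mono)
    finally show "(\<integral>\<^sup>+\<omega>. h (card (SU \<omega> \<inter> cell s z)) \<partial>M) \<le> ennreal (exp (- (lamS * s\<^sup>2)) + \<beta>)" .
  qed
  also have "\<dots> = ennreal ((exp (- (lamS * s\<^sup>2)) + \<beta>) ^ card W)"
    using \<beta> by (subst prod_ennreal) (auto intro: add_nonneg_nonneg)
  finally have "(\<Sum>f\<in>Fs. prob (E f) * \<beta> ^ card {z \<in> W. f z \<noteq> None}) \<le> (exp (- (lamS * s\<^sup>2)) + \<beta>) ^ card W"
    using \<beta> by (subst (asm) ennreal_le_iff) (auto intro: add_nonneg_nonneg)
  with 1 show ?thesis by linarith
qed

section \<open>Geometry and constants\<close>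

lemma sq_dist_real2: "(dist p p')\<^sup>2 = (p $ 1 - p' $ 1)\<^sup>2 + (p $ 2 - p' $ 2)\<^sup>2" for p p' :: "real^2"
  unfolding dist_norm norm_vec_def L2_set_def UNIV_2 by simp

lemma dist_adjacent_cells:
  assumes s: "s > 0" and p: "p \<in> cell s u" "p' \<in> cell s v" and adj: "tri_adj u v"
  shows "dist p p' \<le> 2 * sqrt 2 * s"
proof -
  have close: "\<bar>x - y\<bar> \<le> 2 * s" if "s * of_int i \<le> x" "x < s * of_int (i + 1)" "s * of_int j \<le> y" "y < s * of_int (j + 1)" "\<bar>i - j\<bar> \<le> 1"
    for i j :: int and x y
  proof -
    have ij: "of_int i \<le> of_int j + (1::real)" "of_int j \<le> of_int i + (1::real)" using that(5) by linarith+
    have "s * of_int i \<le> s * (of_int j + 1)" "s * of_int j \<le> s * (of_int i + 1)"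
      using s ij by (auto intro!: mult_left_mono)
    then show ?thesis using that by (simp add: algebra_simps abs_le_iff)
  qed
  have "\<bar>p $ 1 - p' $ 1\<bar> \<le> 2 * s" "\<bar>p $ 2 - p' $ 2\<bar> \<le> 2 * s"
    using p adj close unfolding cell_def tri_adj_def by auto
  then have "(p $ 1 - p' $ 1)\<^sup>2 \<le> (2 * s)\<^sup>2" "(p $ 2 - p' $ 2)\<^sup>2 \<le> (2 * s)\<^sup>2"
    using s abs_le_square_iff[of "p $ 1 - p' $ 1" "2 * s"] abs_le_square_iff[of "p $ 2 - p' $ 2" "2 * s"] by simp_all
  then have "(dist p p')\<^sup>2 \<le> (2 * sqrt 2 * s)\<^sup>2"
    unfolding sq_dist_real2 by (simp add: power_mult_distrib)
  then show ?thesis using s by (simp add: power2_le_iff_abs_le)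
qed

definition closed_cell :: "real \<Rightarrow> int \<times> int \<Rightarrow> (real^2) set" where
  "closed_cell s z = cbox (vector [s * of_int (fst z), s * of_int (snd z)]) (vector [s * of_int (fst z + 1), s * of_int (snd z + 1)])"

lemma mem_closed_cell:
  "p \<in> closed_cell s z \<longleftrightarrow> s * of_int (fst z) \<le> p $ 1 \<and> p $ 1 \<le> s * of_int (fst z + 1) \<and>
     s * of_int (snd z) \<le> p $ 2 \<and> p $ 2 \<le> s * of_int (snd z + 1)"
  by (auto simp: closed_cell_def mem_box_cart forall_2)

text \<open>Compactness provides the finite list, which is why the centres come from the closed
  square: a centre may lie on an edge and belong to several squares.\<close>

lemma ex_cell_centres:
  assumes "\<delta> > 0"
  shows "\<exists>cs. \<forall>z. set (cs z) \<subseteq> closed_cell s z \<and> cell s z \<subseteq> (\<Union>c\<in>set (cs z). cball c \<delta>)"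
proof -
  have "\<exists>l. set l \<subseteq> closed_cell s z \<and> cell s z \<subseteq> (\<Union>c\<in>set l. cball c \<delta>)" for z
  proof -
    have cov: "closed_cell s z \<subseteq> (\<Union>c\<in>closed_cell s z. ball c \<delta>)" using assms by force
    have "compact (closed_cell s z)" by (simp add: closed_cell_def compact_cbox)
    from compactE_image[OF this open_ball cov] obtain C
      where C: "C \<subseteq> closed_cell s z" "finite C" "closed_cell s z \<subseteq> (\<Union>c\<in>C. ball c \<delta>)" .
    obtain l where l: "set l = C" using finite_list[OF C(2)] by blast
    have "cell s z \<subseteq> closed_cell s z" unfolding closed_cell_def by (rule cell_subset_cbox)
    also have "\<dots> \<subseteq> (\<Union>c\<in>C. ball c \<delta>)" by (rule C(3))
    also have "\<dots> \<subseteq> (\<Union>c\<in>C. cball c \<delta>)" by (intro UN_mono order_refl ball_subset_cball)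
    finally show ?thesis using C(1) l by (intro exI[of _ l]) simp
  qed
  then show ?thesis by (intro choice allI)
qed

lemma card_int_set_le:
  fixes X :: "int set"
  assumes "finite X" and "\<And>x y. x \<in> X \<Longrightarrow> y \<in> X \<Longrightarrow> y - x < int k"
  shows "card X \<le> k"
proof (cases "X = {}")
  case False
  have "X \<subseteq> {Min X..<Min X + int k}"
    using assms(1) assms(2)[OF Min_in[OF assms(1) False]] by fastforce
  then have "card X \<le> card {Min X..<Min X + int k}" by (intro card_mono) auto
  then show ?thesis by simp
qed simp

text \<open>The columns \<open>i\<close> and \<open>j\<close> of two such squares satisfy
  \<open>s * (j - i - 1) \<le> 2 * r < s * (k - 1)\<close>, so the squares occupy at most
  \<open>k\<close> columns and likewise at most \<open>k\<close> rows.\<close>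

lemma card_cells_near_point:
  assumes s: "s > 0" and W: "finite W" and c: "\<And>z. z \<in> W \<Longrightarrow> c z \<in> closed_cell s z"
    and r: "2 * r < s * (real k - 1)"
  shows "card {z \<in> W. dist (c z) x \<le> r} \<le> k * k"
proof -
  define Z where "Z = {z \<in> W. dist (c z) x \<le> r}"
  have finZ: "finite Z" using W by (simp add: Z_def)
  have near: "\<bar>c z $ i - x $ i\<bar> \<le> r" if "z \<in> Z" for z i
    using component_le_norm_cart[of "c z - x" i] that by (simp add: Z_def dist_norm)
  have diff: "j - i < int k" if "y' - r \<le> s * of_int (i + 1)" "s * of_int j \<le> y' + r" for i j :: int and y'
  proof -
    have "s * of_int j \<le> s * of_int (i + 1) + 2 * r" using that by linarith
    also have "\<dots> < s * of_int (i + 1) + s * (real k - 1)" using r by simp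
    also have "\<dots> = s * of_int (i + int k)" by (simp add: algebra_simps)
    finally show ?thesis using s by (simp only: mult_less_cancel_left_pos of_int_less_iff)
  qed
  have 1: "fst z' - fst z < int k" if "z \<in> Z" "z' \<in> Z" for z z'
    by (rule diff[of "x $ 1"])
       (use near[OF that(1), of 1] near[OF that(2), of 1] c[of z] c[of z'] that in \<open>auto simp: Z_def mem_closed_cell\<close>)
  have 2: "snd z' - snd z < int k" if "z \<in> Z" "z' \<in> Z" for z z'
    by (rule diff[of "x $ 2"])
       (use near[OF that(1), of 2] near[OF that(2), of 2] c[of z] c[of z'] that in \<open>auto simp: Z_def mem_closed_cell\<close>)
  have "card Z \<le> card (fst ` Z \<times> snd ` Z)"
    using finZ by (intro card_mono) (auto simp: image_iff, force+)
  also have "\<dots> = card (fst ` Z) * card (snd ` Z)" by (rule card_cartesian_product)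
  also have "\<dots> \<le> k * k"
    using finZ 1 2 by (intro mult_le_mono card_int_set_le) auto
  finally show ?thesis by (simp add: Z_def)
qed

section \<open>The overlap integral and the constants of the hypothesis\<close>

lemma common_area_le:
  assumes "r1 > 0" "r2 > 0"
  shows "common_area t r1 r2 \<le> pi * r1\<^sup>2" "common_area t r1 r2 \<le> pi * r2\<^sup>2" "common_area t r1 r2 \<ge> 0"
proof -
  have fm: "cball c r \<in> fmeasurable lborel" for c :: "real^2" and r
    using emeasure_bounded_finite[OF bounded_cball[of c r]] by (simp add: fmeasurable_def borel_closed)
  have "common_area t r1 r2 \<le> measure lborel (cball (0 :: real^2) r1)" "common_area t r1 r2 \<le> measure lborel (cball (vector [t, 0] :: real^2) r2)"
    unfolding common_area_def by (auto intro!: measure_mono_fmeasurable fm simp: borel_closed closed_Int)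
  then show "common_area t r1 r2 \<le> pi * r1\<^sup>2" "common_area t r1 r2 \<le> pi * r2\<^sup>2"
    using assms by (simp_all add: measure_cball_real2)
  show "common_area t r1 r2 \<ge> 0" by (simp add: common_area_def)
qed

lemma common_area_eq_0:
  assumes "t > r1 + r2" "r1 > 0" "r2 > 0"
  shows "common_area t r1 r2 = 0"
proof -
  have "dist (0 :: real^2) (vector [t, 0]) = t"
    using assms by (simp add: norm_vec_def L2_set_def UNIV_2)
  then have "cball (0 :: real^2) r1 \<inter> cball (vector [t, 0]) r2 = {}"
    using assms(1) disjoint_cballI[of r1 r2 "0 :: real^2" "vector [t, 0]"] by simp
  then show ?thesis by (simp add: common_area_def)
qed

text \<open>The factor 2 in \<open>overlap_integral\<close> cancels the 1/2 from integrating
  \<open>c * t\<close> up to the radius \<open>R\<close> beyond which the disks are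
  disjoint.\<close>

lemma overlap_integral_le:
  assumes c: "c \<ge> 0" and R: "0 \<le> R" "R \<le> RI"
    and le: "\<And>t. 0 \<le> t \<Longrightarrow> t \<le> R \<Longrightarrow> common_area t Rp rI / (pi * Rp\<^sup>2) \<le> c"
    and zero: "\<And>t. R < t \<Longrightarrow> t \<le> RI \<Longrightarrow> common_area t Rp rI = 0"
  shows "overlap_integral RI Rp rI \<le> c * R\<^sup>2"
proof -
  define f where "f t = t * (common_area t Rp rI / (pi * Rp\<^sup>2))" for t
  have "((\<lambda>t. c * t) has_integral (c * R\<^sup>2 / 2 - c * 0\<^sup>2 / 2)) {0..R}"
    using R by (intro fundamental_theorem_of_calculus)
      (auto intro!: derivative_eq_intros simp flip: has_real_derivative_iff_has_vector_derivative)
  then have h: "((\<lambda>t. if t \<in> {0..R} then c * t else 0) has_integral (c * R\<^sup>2 / 2)) {0..RI}"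
    using R by (subst has_integral_restrict) auto
  have "integral {0..RI} f \<le> c * R\<^sup>2 / 2"
  proof (cases "f integrable_on {0..RI}")
    case True
    show ?thesis
    proof (rule has_integral_le[OF integrable_integral[OF True] h])
      fix t assume "t \<in> {0..RI}"
      then show "f t \<le> (if t \<in> {0..R} then c * t else 0)"
        using mult_left_mono[OF le, of t t] zero[of t] by (auto simp: f_def mult.commute)
    qed
  next
    \<comment> \<open>\<open>integral\<close> has the default value 0 here, and the bound is
      nonnegative.\<close>
    case False
    then show ?thesis using c by (simp add: not_integrable_integral)
  qed
  then show ?thesis unfolding overlap_integral_def f_def by linarith
qed

text \<open>Two bounds for the overlap are combined. It is at most \<open>RI^2\<close> because the
  area ratio is at most 1, and at most \<open>9 * rI^2\<close> because the ratio is at most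
  \<open>rI^2 / m^2\<close> and vanishes beyond \<open>3 * m > Rp + rI\<close>. The constant 1/10 is
  the value at the crossover \<open>RI^2 = 9 * rI^2\<close>.\<close>

lemma blocking_area_ge:
  assumes "Rp > 0" "RI > 0" "rI > 0"
  shows "(RI\<^sup>2 + rI\<^sup>2) / 10 \<le> RI\<^sup>2 + rI\<^sup>2 - overlap_integral RI Rp rI"
proof -
  define m where "m = max Rp rI"
  have m: "m > 0" "m \<ge> Rp" "m \<ge> rI" using assms by (auto simp: m_def)
  note ca = common_area_le[OF assms(1,3)]
  have p: "common_area t Rp rI / (pi * Rp\<^sup>2) \<le> 1" for t
    using ca(1)[of t] assms by (simp add: divide_le_eq)
  have p2: "common_area t Rp rI / (pi * Rp\<^sup>2) \<le> rI\<^sup>2 / m\<^sup>2" for t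
  proof (cases "Rp \<ge> rI")
    case True
    then have "m = Rp" by (simp add: m_def)
    have "common_area t Rp rI / (pi * Rp\<^sup>2) \<le> (pi * rI\<^sup>2) / (pi * Rp\<^sup>2)"
      using ca(2)[of t] by (intro divide_right_mono) auto
    then show ?thesis using \<open>m = Rp\<close> by simp
  next
    case False
    then have "m = rI" by (simp add: m_def)
    then show ?thesis using p[of t] assms by simp
  qed
  have 1: "overlap_integral RI Rp rI \<le> 1 * RI\<^sup>2"
    using assms p by (intro overlap_integral_le) auto
  have "overlap_integral RI Rp rI \<le> rI\<^sup>2 / m\<^sup>2 * (min RI (3 * m))\<^sup>2"
  proof (rule overlap_integral_le)
    show "common_area t Rp rI = 0" if "min RI (3 * m) < t" "t \<le> RI" for t
      using that m assms by (intro common_area_eq_0) auto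
  qed (use assms m p2 in auto)
  also have "\<dots> \<le> rI\<^sup>2 / m\<^sup>2 * (3 * m)\<^sup>2"
    using assms m by (intro mult_left_mono power_mono) auto
  also have "\<dots> = 9 * rI\<^sup>2" using m by (simp add: power_mult_distrib)
  finally have 2: "overlap_integral RI Rp rI \<le> 9 * rI\<^sup>2" .
  show ?thesis
  proof (cases "RI\<^sup>2 \<le> 9 * rI\<^sup>2")
    case True
    then show ?thesis using 1 by argo
  next
    case False
    then show ?thesis using 2 by argo
  qed
qed

text \<open>The summand \<open>rp / 4\<close> adds 2 to the quotient, which pays for the 1
  subtracted from the ceiling and for the 1 in \<open>real k - 1\<close>.\<close>

lemma dependence_range_bounds:
  assumes "RI > 0" "rp > 0" "rI > 0" "k = dependence_range RI rp rI"
  shows "k \<ge> 2" "8 * RI / rp \<le> real k - 1" "8 * rI / rp \<le> real k - 1"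
proof -
  define x where "x = 8 * max (RI + rp / 4) (rI + rp / 4) / rp"
  have "8 * (RI + rp / 4) / rp \<le> x" "8 * (rI + rp / 4) / rp \<le> x"
    unfolding x_def using assms by (intro divide_right_mono mult_left_mono; simp)+
  moreover have "8 * (r + rp / 4) / rp = 8 * r / rp + 2" for r
    using assms by (simp add: field_simps)
  ultimately have x: "8 * RI / rp + 2 \<le> x" "8 * rI / rp + 2 \<le> x" by simp_all
  have "8 * RI / rp > 0" using assms by simp
  then have "x > 2" using x by linarith
  then have c3: "\<lceil>x\<rceil> \<ge> 3" by linarith
  have k: "k = nat (\<lceil>x\<rceil> - 1)" using assms(4) by (simp add: dependence_range_def x_def)
  show "k \<ge> 2" using c3 k by linarith
  have "real k = of_int \<lceil>x\<rceil> - 1" using c3 k by simp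
  then have "real k \<ge> x - 1" by linarith
  then show "8 * RI / rp \<le> real k - 1" "8 * rI / rp \<le> real k - 1" using x by linarith+
qed

text \<open>As \<open>lamPT\<close> is nonnegative, the logarithm is positive, so its argument
  exceeds 1; this compares the two exponentials. The second bound follows from
  \<open>ln x \<le> x - 1\<close> and \<open>1 / (1 - q) \<le> 1 + 2 * q\<close> for
  \<open>q \<le> 1 / 2\<close>.\<close>

lemma parameter_bounds:
  assumes lam: "lamPT \<ge> 0" "lamS > 0" and "rp > 0" and A: "A > 0" and K: "K \<ge> 1"
    and less: "lamPT < 1 / (pi * A) * ln ((1 - exp (- (lamS * rp\<^sup>2 / 8))) / (1 - (1 / 3) ^ K))"
  shows "exp (- (lamS * rp\<^sup>2 / 8)) < (1 / 3) ^ K" "lamPT * (pi * A) \<le> 2 * (1 / 3) ^ K"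
proof -
  define q :: real where "q = (1 / 3) ^ K"
  define e where "e = exp (- (lamS * rp\<^sup>2 / 8))"
  have e: "0 < e" "e < 1" using lam \<open>rp > 0\<close> by (auto simp: e_def)
  have q: "0 < q" "q \<le> 1 / 2" using K power_decreasing[of 1 K "1 / 3 :: real"] by (auto simp: q_def)
  have l: "lamPT * (pi * A) < ln ((1 - e) / (1 - q))"
    using less A by (simp add: e_def q_def field_simps)
  have "0 \<le> lamPT * (pi * A)" using lam A by simp
  then have "ln ((1 - e) / (1 - q)) > 0" using l by linarith
  then have "(1 - e) / (1 - q) > 1" using e q by (subst (asm) ln_gt_zero_iff) auto
  then have "e < q" using q by (simp add: field_simps)
  then show "exp (- (lamS * rp\<^sup>2 / 8)) < (1 / 3) ^ K" unfolding e_def q_def .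
  have "ln ((1 - e) / (1 - q)) \<le> (1 - e) / (1 - q) - 1" using e q by (intro ln_le_minus_one) auto
  also have "\<dots> \<le> 2 * q"
  proof -
    have "(1 - e) / (1 - q) \<le> 1 / (1 - q)" using e q by (intro divide_right_mono) auto
    also have "\<dots> \<le> 1 + 2 * q" using q mult_right_mono[of q "1/2" q] by (simp add: field_simps)
    finally show ?thesis by simp
  qed
  finally show "lamPT * (pi * A) \<le> 2 * (1 / 3) ^ K" using l by (simp add: q_def)
qed

text \<open>Since 9 = 3^2, the power of 9 cancels the part 4k^2 of the exponent (2k+1)^2 = 4k^2 + 4k
  + 1. What remains is at most 40 / 3^9.\<close>

lemma nine_power_bound:
  assumes "k \<ge> 2"
  shows "9 ^ (k * k + k * k) * (40 * (1 / 3) ^ ((2 * k + 1)\<^sup>2)) \<le> (1 / 100 :: real)"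
proof -
  have e: "(2 * k + 1)\<^sup>2 = 2 * (k * k + k * k) + (4 * k + 1)" by (simp add: power2_eq_square algebra_simps)
  have "9 ^ (k * k + k * k) * (40 * (1 / 3) ^ ((2 * k + 1)\<^sup>2)) = 40 * (9 * (1 / 3 :: real)\<^sup>2) ^ (k * k + k * k) * (1 / 3) ^ (4 * k + 1)"
    unfolding e by (simp only: power_add power_mult power_mult_distrib mult_ac)
  also have "\<dots> = 40 * (1 / 3) ^ (4 * k + 1)" by (simp add: power2_eq_square)
  also have "\<dots> \<le> 40 * (1 / 3) ^ 9" using assms by (intro mult_left_mono power_decreasing) auto
  also have "\<dots> \<le> (1 / 100 :: real)" by (simp add: power_divide)
  finally show ?thesis .
qed

section \<open>From clusters of good squares to components of the network\<close>

lemma infinite_component: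
  assumes s: "s > 0" "2 * sqrt 2 * s \<le> rp"
    and a: "\<And>z. z \<in> G \<Longrightarrow> a z \<in> V \<inter> cell s z \<and> opportunity RI rI PT PR (a z)"
    and inf: "infinite {w. (z, w) \<in> (adj_within G)\<^sup>*}"
  shows "\<exists>C\<in>connected_components_of V (secondary_edges rp RI rI PT PR V). infinite C"
proof -
  define E where "E = secondary_edges rp RI rI PT PR V"
  define H where "H = {w. (z, w) \<in> (adj_within G)\<^sup>*}"
  have "z \<in> G"
  \<comment> \<open>A bad square reaches only itself in the reflexive closure, so its cluster would
    be finite.\<close>
  proof (rule ccontr)
    assume "z \<notin> G"
    have "w = z" if "(z, w) \<in> (adj_within G)\<^sup>*" for w
      using that by (induction rule: rtrancl_induct) (use \<open>z \<notin> G\<close> in \<open>auto simp: adj_within_def\<close>)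
    then have "H \<subseteq> {z}" by (auto simp: H_def)
    then show False using inf finite_subset by (auto simp: H_def)
  qed
  then have HG: "H \<subseteq> G" using adj_within_rtrancl_mem unfolding H_def by blast
  have reach: "(a z, a w) \<in> E\<^sup>*" if "(z, w) \<in> (adj_within G)\<^sup>*" for w
    using that
  proof (induction rule: rtrancl_induct)
    case (step u v)
    then have uv: "u \<in> G" "v \<in> G" "tri_adj u v" by (auto simp: adj_within_def)
    have "dist (a u) (a v) \<le> 2 * sqrt 2 * s"
      using a[OF uv(1)] a[OF uv(2)] uv(3) s by (intro dist_adjacent_cells) auto
    \<comment> \<open>Adjacency is reflexive, whereas an edge requires two distinct users.\<close>
    then have "a u = a v \<or> (a u, a v) \<in> E"
      using a[OF uv(1)] a[OF uv(2)] s(2) by (auto simp: E_def secondary_edges_def)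
    then show ?case using step.IH by (auto intro: rtrancl_into_rtrancl)
  qed simp
  have "inj_on a H"
  proof (rule inj_onI)
    fix u v assume "u \<in> H" "v \<in> H" "a u = a v"
    then have "a u \<in> cell s u \<inter> cell s v" using a HG by fastforce
    then show "u = v" using cell_disjoint[OF s(1), of u v] by auto
  qed
  then have inf': "infinite (a ` H)" using inf by (simp add: H_def finite_image_iff)
  define Rel where "Rel = {(x, y). x \<in> V \<and> y \<in> V \<and> (x, y) \<in> E\<^sup>*}"
  have "(a z, a w) \<in> Rel" if "w \<in> H" for w
    using a[OF \<open>z \<in> G\<close>] a[of w] that HG reach[of w] by (auto simp: Rel_def H_def)
  then have "a ` H \<subseteq> Rel `` {a z}" by blast
  then have "infinite (Rel `` {a z})" using inf' finite_subset by blast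
  moreover have "Rel `` {a z} \<in> connected_components_of V E"
    unfolding connected_components_of_def Rel_def using a[OF \<open>z \<in> G\<close>] by (intro quotientI) auto
  ultimately show ?thesis unfolding E_def by blast
qed

section \<open>Percolation\<close>

definition tri_walks :: "nat \<Rightarrow> (int \<times> int) list set" where
  "tri_walks m = {xs. length xs = Suc m \<and> hd xs = (int (Suc m), 0) \<and> successively tri_adj xs \<and> distinct xs}"

lemma finite_tri_walks: "finite (tri_walks m)" and card_tri_walks: "card (tri_walks m) \<le> 7 ^ m"
proof -
  let ?W = "{xs. length xs = Suc m \<and> hd xs = (int (Suc m), 0) \<and> successively tri_adj xs}"
  have sub: "tri_walks m \<subseteq> ?W" by (auto simp: tri_walks_def)
  have W: "finite ?W" "card ?W \<le> 7 ^ m" using finite_card_tri_walks[of m "(int (Suc m), 0)"] by blast+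
  show "finite (tri_walks m)" by (rule finite_subset[OF sub W(1)])
  show "card (tri_walks m) \<le> 7 ^ m" by (rule order_trans[OF card_mono[OF W(1) sub] W(2)])
qed

text \<open>The constant 7 is the number of lattice neighbours, a site being its own neighbour.\<close>

lemma (in prob_space) AE_infinite_good_cluster:
  assumes ev: "\<And>z. {\<omega> \<in> space M. bad z \<omega>} \<in> events"
    and bound: "\<And>W. finite W \<Longrightarrow> prob {\<omega> \<in> space M. \<forall>z\<in>W. bad z \<omega>} \<le> p ^ card W"
    and p: "0 \<le> p" "7 * p < 1"
  shows "AE \<omega> in M. \<exists>z. infinite {w. (z, w) \<in> (adj_within {z. \<not> bad z \<omega>})\<^sup>*}"
proof -
  define F where "F m = (\<Union>xs\<in>tri_walks m. {\<omega> \<in> space M. \<forall>z\<in>set xs. bad z \<omega>})" for m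
  have wm: "{\<omega> \<in> space M. \<forall>z\<in>set xs. bad z \<omega>} \<in> events" for xs
    by (rule sets.sets_Collect_finite_All) (auto intro: ev)
  have Fm: "F m \<in> events" for m
    unfolding F_def using finite_tri_walks wm by (intro sets.finite_UN) auto
  have prF: "prob (F m) \<le> p * (7 * p) ^ m" for m
  proof -
    have "prob (F m) \<le> (\<Sum>xs\<in>tri_walks m. prob {\<omega> \<in> space M. \<forall>z\<in>set xs. bad z \<omega>})"
      unfolding F_def using finite_tri_walks wm by (intro measure_UNION_le) auto
    also have "\<dots> \<le> (\<Sum>xs\<in>tri_walks m. p ^ Suc m)"
    proof (rule sum_mono)
      fix xs assume "xs \<in> tri_walks m"
      \<comment> \<open>Self-avoidance matters here: the squares visited are distinct, so the bound
        carries the full exponent.\<close>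
      then have "card (set xs) = Suc m" by (simp add: tri_walks_def distinct_card)
      then show "prob {\<omega> \<in> space M. \<forall>z\<in>set xs. bad z \<omega>} \<le> p ^ Suc m" using bound[of "set xs"] by simp
    qed
    also have "\<dots> = real (card (tri_walks m)) * p ^ Suc m" by simp
    also have "\<dots> \<le> 7 ^ m * p ^ Suc m"
      using p(1) card_tri_walks[of m] by (intro mult_right_mono) (auto simp: numeral_power_le_of_nat_cancel_iff of_nat_le_numeral_power_cancel_iff)
    finally show ?thesis by (simp add: power_mult_distrib mult_ac)
  qed
  have "summable (\<lambda>m. prob (F m))"
  proof (rule summable_comparison_test')
    show "summable (\<lambda>m. p * (7 * p) ^ m)" using p by (intro summable_mult summable_geometric) auto
    show "norm (prob (F m)) \<le> p * (7 * p) ^ m" if "m \<ge> 0" for m using prF by simp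
  qed
  then have "AE \<omega> in M. eventually (\<lambda>m. \<omega> \<in> space M - F m) sequentially"
    using Fm by (intro borel_cantelli_AE1) (auto simp: emeasure_eq_measure)
  then show ?thesis
  proof eventually_elim
    case (elim \<omega>)
    then obtain n where n: "\<And>m. m \<ge> n \<Longrightarrow> \<omega> \<in> space M - F m" by (auto simp: eventually_sequentially)
    show ?case
    proof (rule ccontr)
      assume "\<nexists>z. infinite {w. (z, w) \<in> (adj_within {z. \<not> bad z \<omega>})\<^sup>*}"
      then have "finite {w. (z, w) \<in> (adj_within {z. \<not> bad z \<omega>})\<^sup>*}" for z by blast
      then have "\<exists>m>n. \<exists>xs. bad_walk (\<lambda>z. bad z \<omega>) m xs" by (rule infinite_cluster_or_bad_walk)
      then obtain m xs where m: "m > n" and xs: "bad_walk (\<lambda>z. bad z \<omega>) m xs" by blast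
      \<comment> \<open>Walks of \<open>m\<close> squares are filed under \<open>m - 1\<close>, so
        the strict inequality \<open>m > n\<close> is what keeps the index at or above
        \<open>n\<close>.\<close>
      then obtain m' where m': "m = Suc m'" "m' \<ge> n" by (cases m) auto
      have "xs \<in> tri_walks m'" using xs m' by (simp add: bad_walk_def tri_walks_def)
      moreover have "\<forall>z\<in>set xs. bad z \<omega>" using xs by (simp add: bad_walk_def)
      ultimately have "\<omega> \<in> F m'" using n[OF m'(2)] by (auto simp: F_def)
      then show False using n[OF m'(2)] by simp
    qed
  qed
qed

theorem corollary2:
  fixes Rp RI rp rI lamS lamPT :: real
    and M :: "'w measure"
    and SU :: "'w \<Rightarrow> (real^2) set"
    and N :: "'w \<Rightarrow> enat"
    and T D :: "nat \<Rightarrow> 'w \<Rightarrow> real^2"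
    and k :: nat
  assumes "Rp > 0" and "RI > 0" and "rp > 0" and "rI > 0"
    and "lamS > 0" and "lamPT \<ge> 0"
    and "heterogeneous_network M lamS lamPT Rp SU N T D"
    and "k = dependence_range RI rp rI"
    and "lamPT < 1 / (pi * (RI\<^sup>2 + rI\<^sup>2 - overlap_integral RI Rp rI)) *
           ln ((1 - exp (- (lamS * rp\<^sup>2 / 8))) / (1 - (1 / 3) ^ ((2 * k + 1)\<^sup>2)))"
  shows "secondary_network_connected M rp RI rI SU N T D"
proof -
  interpret heterogeneous_network M lamS lamPT Rp SU N T D by fact
  define A where "A = RI\<^sup>2 + rI\<^sup>2 - overlap_integral RI Rp rI"
  define q :: real where "q = (1 / 3) ^ ((2 * k + 1)\<^sup>2)"
  have RI2: "RI\<^sup>2 > 0" "rI\<^sup>2 > 0" using assms by auto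
  have A10: "RI\<^sup>2 + rI\<^sup>2 \<le> 10 * A"
    using blocking_area_ge[OF assms(1,2,4)] by (simp add: A_def)
  then have A0: "A > 0" using RI2 by linarith
  note k = dependence_range_bounds[OF \<open>RI > 0\<close> \<open>rp > 0\<close> \<open>rI > 0\<close> assms(8)]
  have par: "exp (- (lamS * rp\<^sup>2 / 8)) < q" "lamPT * (pi * A) \<le> 2 * q"
    unfolding q_def
    by (rule parameter_bounds[OF assms(6,5,3) A0]; use assms(9) in \<open>simp add: A_def\<close>)+
  \<comment> \<open>The side for which \<open>2 * sqrt 2 * s\<close> is exactly \<open>rp\<close>;
    then \<open>s^2\<close> is the \<open>rp^2 / 8\<close> of the hypothesis.\<close>
  define s where "s = rp / (2 * sqrt 2)"
  have s: "s > 0" using assms by (simp add: s_def)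
  have s2: "s\<^sup>2 = rp\<^sup>2 / 8" by (simp add: s_def power_divide power_mult_distrib)
  have srp: "2 * sqrt 2 * s = rp" by (simp add: s_def)
  \<comment> \<open>Enlarging the radii by a factor of at most 7/5 < \<open>sqrt 2\<close> keeps
    \<open>2 * (r + \<delta>)\<close> strictly below
    \<open>2 * sqrt 2 * r = s * (8 * r / rp)\<close>, so \<open>k\<close> still fits, and at most
    doubles the areas.\<close>
  define \<delta> where "\<delta> = 2 / 5 * min RI rI"
  have \<delta>: "\<delta> > 0" "RI + \<delta> \<le> 7 / 5 * RI" "rI + \<delta> \<le> 7 / 5 * rI" using assms by (auto simp: \<delta>_def)
  have fit: "2 * (r + \<delta>) < s * (real k - 1)" if "r > 0" "r + \<delta> \<le> 7 / 5 * r" "8 * r / rp \<le> real k - 1" for r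
  proof -
    have "7 / 5 < sqrt 2" by (rule real_less_rsqrt) (simp add: power2_eq_square)
    then have "7 / 5 * r < sqrt 2 * r" using that(1) by (rule mult_strict_right_mono)
    then have "2 * (r + \<delta>) < 2 * (sqrt 2 * r)" using that(2) by (simp add: algebra_simps)
    also have "2 * (sqrt 2 * r) = s * (8 * r / rp)"
      using \<open>rp > 0\<close> by (simp add: s_def field_simps)
    also have "\<dots> \<le> s * (real k - 1)" using s that by (intro mult_left_mono) auto
    finally show ?thesis .
  qed
  obtain cs where cs: "\<And>z. set (cs z) \<subseteq> closed_cell s z" "\<And>z. cell s z \<subseteq> (\<Union>c\<in>set (cs z). cball c \<delta>)"
    using ex_cell_centres[OF \<delta>(1), of s] by blast
  have block: "prob {\<omega> \<in> space M. \<forall>z\<in>V. blocked (RI + \<delta>) (rI + \<delta>) (c z) (N \<omega>, \<lambda>n. T n \<omega>, \<lambda>n. D n \<omega>)} \<le> (1 / 8) ^ card V"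
    if V: "finite V" and c: "\<And>z. z \<in> V \<Longrightarrow> c z \<in> set (cs z)" for V c
  proof -
    have cc: "c z \<in> closed_cell s z" if "z \<in> V" for z using c[OF that] cs(1) by blast
    have "9 ^ card V * prob {\<omega> \<in> space M. \<forall>z\<in>V. blocked (RI + \<delta>) (rI + \<delta>) (c z) (N \<omega>, \<lambda>n. T n \<omega>, \<lambda>n. D n \<omega>)}
      \<le> exp (lamPT * (9 ^ (k * k + k * k) * (card V * (pi * (RI + \<delta>)\<^sup>2 + pi * (rI + \<delta>)\<^sup>2))))"
      using assms \<delta> k
      by (intro primary_blocking_bound[OF V] card_cells_near_point[OF s V cc] fit) auto
    also have "\<dots> \<le> exp (real (card V) * (1 / 100))"
    proof (subst exp_le_cancel_iff)
      \<comment> \<open>The factor 40 is 2 from the enlarged areas, 10 from comparing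
        \<open>RI^2 + rI^2\<close> with \<open>A\<close>, and 2 from
        \<open>lamPT * (pi * A) \<le> 2 * q\<close>.\<close>
      have "(RI + \<delta>)\<^sup>2 \<le> (7 / 5 * RI)\<^sup>2" "(rI + \<delta>)\<^sup>2 \<le> (7 / 5 * rI)\<^sup>2"
        using \<delta> assms by (auto intro!: power_mono)
      moreover have "(7 / 5 * r)\<^sup>2 \<le> 2 * r\<^sup>2" for r :: real
        by (simp add: power_mult_distrib power_divide)
      ultimately have "(RI + \<delta>)\<^sup>2 + (rI + \<delta>)\<^sup>2 \<le> 2 * RI\<^sup>2 + 2 * rI\<^sup>2"
        by (meson add_mono order_trans)
      also have "\<dots> \<le> 20 * A" using A10 by simp
      finally have "(RI + \<delta>)\<^sup>2 + (rI + \<delta>)\<^sup>2 \<le> 20 * A" .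
      then have "lamPT * (pi * ((RI + \<delta>)\<^sup>2 + (rI + \<delta>)\<^sup>2)) \<le> lamPT * (pi * (20 * A))"
        using assms by (intro mult_left_mono) auto
      also have "\<dots> = 20 * (lamPT * (pi * A))" by simp
      also have "\<dots> \<le> 20 * (2 * q)" using par(2) by (rule mult_left_mono) simp
      also have "\<dots> = 40 * q" by simp
      finally have "9 ^ (k * k + k * k) * (lamPT * (pi * ((RI + \<delta>)\<^sup>2 + (rI + \<delta>)\<^sup>2))) \<le> 9 ^ (k * k + k * k) * (40 * q)"
        by (intro mult_left_mono) auto
      also have "\<dots> \<le> 1 / 100" unfolding q_def by (rule nine_power_bound[OF k(1)])
      finally have "real (card V) * (9 ^ (k * k + k * k) * (lamPT * (pi * ((RI + \<delta>)\<^sup>2 + (rI + \<delta>)\<^sup>2)))) \<le> real (card V) * (1 / 100)"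
        by (intro mult_left_mono) auto
      then show "lamPT * (9 ^ (k * k + k * k) * (card V * (pi * (RI + \<delta>)\<^sup>2 + pi * (rI + \<delta>)\<^sup>2))) \<le> real (card V) * (1 / 100)"
        by (simp add: algebra_simps)
    qed
    also have "\<dots> = exp (1 / 100) ^ card V" by (rule exp_of_nat_mult)
    also have "\<dots> \<le> (9 / 8) ^ card V"
    proof (rule power_mono)
      have "exp (1 / 100 :: real) \<le> 1 + 1 / 100 + (1 / 100)\<^sup>2" by (rule exp_bound) auto
      then show "exp (1 / 100 :: real) \<le> 9 / 8" by (simp add: power2_eq_square)
    qed simp
    also have "\<dots> = 9 ^ card V * (1 / 8) ^ card V" by (simp flip: power_mult_distrib)
    finally show ?thesis by simp
  qed
  define bad where "bad z \<omega> = site_bad s \<delta> cs (RI + \<delta>) (rI + \<delta>) z (SU \<omega>) (N \<omega>, \<lambda>n. T n \<omega>, \<lambda>n. D n \<omega>)" for z \<omega>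
  \<comment> \<open>As \<open>k \<ge> 2\<close>, the exponent in \<open>q\<close> is at least 25;
    already exponent 4 gives 1/81, and 7 * (1/81 + 1/8) < 1.\<close>
  have small: "exp (- (lamS * s\<^sup>2)) \<le> 1 / 81"
  proof -
    have "(4 :: nat) \<le> 5\<^sup>2" by simp
    also have "\<dots> \<le> (2 * k + 1)\<^sup>2" using k(1) by (intro power_mono) auto
    finally have "q \<le> (1 / 3) ^ 4" unfolding q_def by (intro power_decreasing) auto
    then show ?thesis using par(1) by (simp add: s2 power_divide)
  qed
  have "AE \<omega> in M. \<exists>z. infinite {w. (z, w) \<in> (adj_within {z. \<not> bad z \<omega>})\<^sup>*}"
  proof (rule AE_infinite_good_cluster)
    show "{\<omega> \<in> space M. bad z \<omega>} \<in> events" for z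
      unfolding bad_def by (rule site_bad_event)
    show "prob {\<omega> \<in> space M. \<forall>z\<in>W. bad z \<omega>} \<le> (exp (- (lamS * s\<^sup>2)) + 1 / 8) ^ card W" if "finite W" for W
      unfolding bad_def using that s cs(2) block \<open>lamS > 0\<close> by (intro site_bad_bound) auto
  qed (use small in auto)
  then show ?thesis
    unfolding secondary_network_connected_def
  proof eventually_elim
    case (elim \<omega>)
    let ?PT = "transmitters N T \<omega>" and ?PR = "receivers N T D \<omega>"
    \<comment> \<open>The centre is clear of primary users up to the enlarged radii, so by the
      triangle inequality a user within \<open>\<delta>\<close> of it is clear up to
      \<open>RI\<close> and \<open>rI\<close>.\<close>
    have "\<exists>p. p \<in> SU \<omega> \<inter> cell s z \<and> opportunity RI rI ?PT ?PR p" if good: "\<not> bad z \<omega>" for z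
    proof -
      obtain c where c: "pick s \<delta> cs z (SU \<omega>) = Some c"
        and nb: "\<not> blocked (RI + \<delta>) (rI + \<delta>) c (N \<omega>, \<lambda>n. T n \<omega>, \<lambda>n. D n \<omega>)"
        using good unfolding bad_def site_bad_def by blast
      obtain p where p: "p \<in> SU \<omega>" "p \<in> cell s z" "dist c p \<le> \<delta>" using pick_SomeD(2)[OF c] by auto
      have "dist p x > r" if "dist c x > r + \<delta>" for x r using that p(3) dist_triangle[of c x p] by linarith
      moreover have "dist c (T n \<omega>) > RI + \<delta>" "dist c (T n \<omega> + D n \<omega>) > rI + \<delta>" if "enat n < N \<omega>" for n
        using nb that by (auto simp: blocked_def not_le)
      ultimately have "opportunity RI rI ?PT ?PR p"
        by (fastforce simp: opportunity_def transmitters_def receivers_def not_le)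
      then show ?thesis using p by blast
    qed
    then obtain a where a: "\<And>z. z \<in> {z. \<not> bad z \<omega>} \<Longrightarrow> a z \<in> SU \<omega> \<inter> cell s z \<and> opportunity RI rI ?PT ?PR (a z)"
      by (metis mem_Collect_eq)
    obtain z where inf: "infinite {w. (z, w) \<in> (adj_within {z. \<not> bad z \<omega>})\<^sup>*}" using elim by blast
    show ?case by (rule infinite_component[OF s _ a inf]) (simp_all add: srp)
  qed
qed

end
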